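(* Let $1\le p<\infty$ and let $\omega$ belong to the Sobolev space $W^{1,p}(\mathbf{D})$. Then the best approximant $f^\star\in A^p$ to $\omega$ belongs to the Hardy space $H^p$.
   Context: $\mathbf{D}$ is the open unit disk in $\mathbf{C}$ with normalized area measure $dA=\frac1\pi\,dx\,dy$; $L^p=L^p(\mathbf{D},dA)$; $A^p$ is the Bergman space of analytic functions on $\mathbf{D}$ belonging to $L^p$. A best approximant to $\omega$ in $A^p$ is a function $f^\star\in A^p$ with $\|\omega-f^\star\|_p=\inf_{f\in A^p}\|\omega-f\|_p$. For $\omega\in W^{1,p}(\mathbf{D})$ such a best approximant exists and is unique, including when $p=1$. $H^p$ is the Hardy space of analytic functions $f$ on $\mathbf{D}$ with $\sup_{0<r<1}\int_0^{2\pi}|f(re^{i\theta})|^p\,d\theta<\infty$. *)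

theory Defs
  imports "HOL-Analysis.Analysis"
begin

abbreviation unit_disk :: "complex set" where
  "unit_disk \<equiv> ball 0 1"

definition area :: "complex measure" where
  "area = scale_measure (ennreal (1 / pi)) (lebesgue_on unit_disk)"

(* Elements of L^p are represented by functions on all of the complex plane;
   values outside the disk are irrelevant, and classes modulo null sets are not formed. *)
definition Lp :: "real \<Rightarrow> (complex \<Rightarrow> complex) set" where
  "Lp p = {f. f \<in> borel_measurable area \<and> integrable area (\<lambda>z. norm (f z) powr p)}"

definition Lp_norm :: "real \<Rightarrow> (complex \<Rightarrow> complex) \<Rightarrow> real" where
  "Lp_norm p f = (\<integral>z. norm (f z) powr p \<partial>area) powr (1 / p)"

definition bergman :: "real \<Rightarrow> (complex \<Rightarrow> complex) set" where
  "bergman p = {f. f holomorphic_on unit_disk \<and> f \<in> Lp p}"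

definition best_approximant :: "real \<Rightarrow> (complex \<Rightarrow> complex) \<Rightarrow> (complex \<Rightarrow> complex) \<Rightarrow> bool" where
  "best_approximant p \<omega> f \<longleftrightarrow>
     f \<in> bergman p \<and>
     Lp_norm p (\<lambda>z. \<omega> z - f z) = (INF g\<in>bergman p. Lp_norm p (\<lambda>z. \<omega> z - g z))"

definition hardy :: "real \<Rightarrow> (complex \<Rightarrow> complex) set" where
  "hardy p = {f. f holomorphic_on unit_disk \<and>
     bdd_above ((\<lambda>r. integral {0..2 * pi} (\<lambda>\<theta>. norm (f (of_real r * cis \<theta>)) powr p)) ` {0<..<1})}"

abbreviation dir_deriv :: "(complex \<Rightarrow> real) \<Rightarrow> complex \<Rightarrow> complex \<Rightarrow> real" where
  "dir_deriv \<phi> v z \<equiv> frechet_derivative \<phi> (at z) v"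

(* C^k in the real sense: Basis = {1, \<i>} for complex, so the recursion runs over the
   partial derivatives in x and y. *)
primrec C_k :: "nat \<Rightarrow> (complex \<Rightarrow> real) \<Rightarrow> bool" where
  "C_k 0 \<phi> \<longleftrightarrow> continuous_on UNIV \<phi>"
| "C_k (Suc k) \<phi> \<longleftrightarrow> (\<forall>z. \<phi> differentiable (at z)) \<and> (\<forall>v\<in>Basis. C_k k (dir_deriv \<phi> v))"

definition test_functions :: "(complex \<Rightarrow> real) set" where
  "test_functions = {\<phi>. (\<forall>k. C_k k \<phi>) \<and>
     compact (closure {z. \<phi> z \<noteq> 0}) \<and> closure {z. \<phi> z \<noteq> 0} \<subseteq> unit_disk}"

(* The integrals are meaningful for u and g integrable over the disk; in particular for
   elements of Lp p with p \<ge> 1, since the disk has finite area. *)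
definition weak_deriv :: "complex \<Rightarrow> (complex \<Rightarrow> complex) \<Rightarrow> (complex \<Rightarrow> complex) \<Rightarrow> bool" where
  "weak_deriv v u g \<longleftrightarrow>
     (\<forall>\<phi>\<in>test_functions.
        (\<integral>z. u z * of_real (dir_deriv \<phi> v z) \<partial>area) = - (\<integral>z. g z * of_real (\<phi> z) \<partial>area))"

definition sobolev :: "real \<Rightarrow> (complex \<Rightarrow> complex) set" where
  "sobolev p = {u. u \<in> Lp p \<and> (\<exists>u\<^sub>x\<in>Lp p. weak_deriv 1 u u\<^sub>x) \<and> (\<exists>u\<^sub>y\<in>Lp p. weak_deriv \<i> u u\<^sub>y)}"

end

theory Submission
  imports Defs "HOL-Complex_Analysis.Conformal_Mappings"
begin

text \<open>Let \<open>f\<close> be the best approximant and compare it with its dilations \<open>f\<^sub>r z = f (r z)\<close>, which lie in the Bergman space.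
  A radial weak derivative estimate gives \<open>\<parallel>\<omega> - \<omega>\<^sub>r\<parallel> \<le> C (1 - r)\<close> in \<open>L\<^sup>p\<close>, while \<open>\<omega>\<^sub>r - f\<^sub>r\<close> is a dilation of \<open>\<omega> - f\<close>,
  so its norm only sees the disk of radius \<open>r\<close>. Minimality \<open>\<parallel>\<omega> - f\<parallel> \<le> \<parallel>\<omega> - f\<^sub>r\<parallel>\<close> therefore forces the integral of
  \<open>|\<omega> - f|\<^sup>p\<close> over the annulus \<open>r < |z| < 1\<close> to be \<open>O(1 - r)\<close>. The same argument with \<open>f\<close> replaced by \<open>0\<close> bounds
  the integral of \<open>|\<omega>|\<^sup>p\<close>, hence that of \<open>|f|\<^sup>p\<close>. As the circle means of \<open>|f|\<^sup>p\<close> increase with the radius,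
  they are bounded.\<close>

section \<open>Convexity of powers\<close>

text \<open>The only competitors are the dilations of \<open>f\<close> itself. The variational
  identity for an extremal is never formed, so \<open>p = 1\<close> is treated together with
  \<open>p > 1\<close>. The rate O(1 - r) is the right one because the annulus has area \<pi>(1 -
  r^2): comparing the two leaves a bound for the circle mean that is free of r. The obstacle is that
  \<omega> has derivatives only against test functions. No smooth approximation of \<omega> is made.
  The identity expressing \<omega>(z) - \<omega>(rz) by the radial derivative is proved after
  pairing both sides with a test function \<phi>: a change of variables moves the dilation onto
  \<phi>, and the differentiation in t acts on \<phi>(z/t)/t^2. Only products u(x) v(y) are used as
  \<phi>, since their smoothness reduces to one variable and they already determine an integrable
  function almost everywhere. In the final estimate r stays in [1/2, 1), which keeps negative powers
  of r bounded; smaller radii follow from the monotonicity of the circle means.\<close>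

lemma powr_add_le_weighted:
  fixes a b l p :: real
  assumes "1 \<le> p" "0 < l" "l < 1" "0 \<le> a" "0 \<le> b"
  shows "(a + b) powr p \<le> l powr (1 - p) * a powr p + (1 - l) powr (1 - p) * b powr p"
proof -
  have ge1: "1 \<le> t powr (1 - p)" if "0 < t" "t < 1" for t :: real
    using that assms powr_mono2'[of "1 - p" t 1] by simp
  have ge: "x powr p \<le> t powr (1 - p) * x powr p" if "0 < t" "t < 1" for t x :: real
    using mult_right_mono[OF ge1[OF that], of "x powr p"] by simp
  consider "a = 0" | "b = 0" | "0 < a" "0 < b" using assms by linarith
  then show ?thesis
  proof cases
    case 1 then show ?thesis using ge[of "1 - l" b] assms by simp
  next
    case 2 then show ?thesis using ge[of l a] assms by simp
  next
    case 3
    have sc: "t * (x / t) powr p = t powr (1 - p) * x powr p" if "0 < t" "0 < x" for t x :: real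
      using that by (simp add: powr_divide powr_diff field_simps)
    \<comment> \<open>The sum is the convex combination of \<open>a / l\<close> and
      \<open>b / (1 - l)\<close> with weights \<open>l\<close> and \<open>1 - l\<close>. Pulling the
      denominators out of the powers leaves the exponents \<open>1 - p\<close>.\<close>
    have "((1 - (1 - l)) *\<^sub>R (a / l) + (1 - l) *\<^sub>R (b / (1 - l))) powr p
        \<le> (1 - (1 - l)) * (a / l) powr p + (1 - l) * (b / (1 - l)) powr p"
      using 3 assms by (intro convex_onD[OF powr_convex]) auto
    then show ?thesis using 3 assms sc[of l a] sc[of "1 - l" b] by simp
  qed
qed

text \<open>The free weight is the point. With \<open>l = r\<close> the first coefficient tends to 1
  as r does, while the second, \<open>(1 - r) powr (1 - p)\<close>, is compensated by a summand of
  size \<open>(1 - r) powr p\<close>. An even split would cost the factor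
  \<open>2 powr (p - 1)\<close> in the main term.\<close>

lemma norm_add_powr_le_weighted:
  fixes x y :: "'a::real_normed_vector" and l p :: real
  assumes "1 \<le> p" "0 < l" "l < 1"
  shows "norm (x + y) powr p \<le> l powr (1 - p) * norm x powr p + (1 - l) powr (1 - p) * norm y powr p"
  using powr_mono2[OF _ norm_ge_zero norm_triangle_ineq[of x y], of p]
    powr_add_le_weighted[OF assms norm_ge_zero norm_ge_zero, of x y] assms by linarith

lemma norm_add_powr_le:
  fixes x y :: "'a::real_normed_vector" and p :: real
  assumes "1 \<le> p"
  shows "norm (x + y) powr p \<le> 2 powr (p - 1) * (norm x powr p + norm y powr p)"
proof -
  have "(1/2::real) powr (1 - p) = 2 powr (p - 1)"
    by (simp add: powr_divide powr_minus_divide [of 2 "p - 1", simplified])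
  then show ?thesis
    using norm_add_powr_le_weighted[OF assms, of "1/2" x y] by (simp add: distrib_left)
qed

text \<open>Young's inequality for the exponents p/(p - 1) and p, written so that
  \<open>p = 1\<close> is included. It serves in the Jensen-type bound below, in the duality
  estimate for circle means, and with \<open>m = 1\<close> as Bernoulli's inequality.\<close>

lemma young_powr:
  fixes a m p :: real
  assumes "1 \<le> p" "0 \<le> a" "0 \<le> m"
  shows "m powr (p - 1) * a \<le> (p - 1) / p * m powr p + 1 / p * a powr p"
proof (cases "a = 0 \<or> m = 0")
  case True
  then show ?thesis using assms by auto
next
  case False
  then have "(m powr p) powr ((p - 1) / p) * (a powr p) powr (1 / p)
      \<le> (p - 1) / p * m powr p + 1 / p * a powr p"
    using assms by (intro Youngs_inequality_0) (auto simp: field_simps)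
  then show ?thesis using False assms by (simp add: powr_powr)
qed

text \<open>Jensen's inequality, obtained by integrating Young's inequality with \<open>m\<close>
  the mean of \<open>f\<close>; multiplication by \<open>p\<close> then cancels all but one copy of
  \<open>m powr p\<close> times the total mass. If \<open>f powr p\<close> is not integrable,
  positivity of the mass makes the right-hand side infinite.\<close>

lemma (in finite_measure) powr_integral_le:
  fixes f :: "'a \<Rightarrow> real"
  assumes p: "1 \<le> p" and f: "integrable M f" and f0: "\<And>x. 0 \<le> f x"
    and L: "0 < measure M (space M)"
  shows "ennreal ((\<integral>x. f x \<partial>M) powr p)
    \<le> ennreal (measure M (space M) powr (p - 1)) * (\<integral>\<^sup>+x. ennreal (f x powr p) \<partial>M)"
proof (cases "(\<integral>\<^sup>+x. ennreal (f x powr p) \<partial>M) = \<infinity>")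
  case True
  then show ?thesis using L by (simp add: ennreal_mult_top)
next
  case False
  note [measurable] = borel_measurable_integrable[OF f]
  have fp: "integrable M (\<lambda>x. f x powr p)"
    using False by (intro integrableI_bounded) (auto simp: top.not_eq_extremum)
  define L where "L = measure M (space M)"
  define m where "m = (\<integral>x. f x \<partial>M) / L"
  have L0: "0 < L" and m0: "0 \<le> m" using L f0 by (auto simp: L_def m_def)
  have "(\<integral>x. m powr (p - 1) * f x \<partial>M) \<le> (\<integral>x. (p - 1) / p * m powr p + 1 / p * f x powr p \<partial>M)"
    using f fp p f0 m0 by (intro integral_mono young_powr) auto
  then have "m powr (p - 1) * (m * L) \<le> (p - 1) / p * m powr p * L + 1 / p * (\<integral>x. f x powr p \<partial>M)"
    using f fp L0 by (simp add: m_def L_def[symmetric] algebra_simps)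
  moreover have "m powr (p - 1) * m = m powr p"
    using m0 p by (cases "m = 0") (auto simp: powr_diff)
  ultimately have "p * (m powr p * L) \<le> p * ((p - 1) / p * m powr p * L + 1 / p * (\<integral>x. f x powr p \<partial>M))"
    using p by (simp add: mult.assoc[symmetric])
  also have "\<dots> = (p - 1) * (m powr p * L) + (\<integral>x. f x powr p \<partial>M)"
    using p by (simp add: distrib_left)
  finally have "m powr p * L \<le> (\<integral>x. f x powr p \<partial>M)"
    by (simp add: left_diff_distrib)
  then have "L powr (p - 1) * (m powr p * L) \<le> L powr (p - 1) * (\<integral>x. f x powr p \<partial>M)"
    by (intro mult_left_mono) auto
  also have "L powr (p - 1) * (m powr p * L) = (m * L) powr p"
    using L0 m0 by (simp add: powr_mult powr_diff)
  finally show ?thesis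
    using f0 L0 nn_integral_eq_integral[OF fp]
    by (simp add: L_def[symmetric] m_def ennreal_mult'[symmetric] ennreal_leI)
qed

section \<open>Dilations and rotations of Lebesgue measure\<close>

lemma nn_integral_lborel_scaleR:
  fixes h :: "'a::euclidean_space \<Rightarrow> ennreal"
  assumes [measurable]: "h \<in> borel_measurable borel" and "0 < c"
  shows "(\<integral>\<^sup>+z. h z \<partial>lborel) = ennreal (c ^ DIM('a)) * (\<integral>\<^sup>+z. h (c *\<^sub>R z) \<partial>lborel)"
  by (subst lborel_affine[of c 0]) (use assms(2) in \<open>auto simp: nn_integral_density nn_integral_distr nn_integral_cmult\<close>)

lemma integrable_lborel_scaleR:
  fixes h :: "'a::euclidean_space \<Rightarrow> 'b::{banach, second_countable_topology}"
  assumes "integrable lborel h" "0 < c"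
  shows "integrable lborel (\<lambda>z. h (c *\<^sub>R z))"
proof -
  have [measurable]: "h \<in> borel_measurable borel" using assms by auto
  have "(\<integral>\<^sup>+z. norm (h z) \<partial>lborel) < \<infinity>" using assms by (simp add: integrable_iff_bounded)
  then have "ennreal (c ^ DIM('a)) * (\<integral>\<^sup>+z. norm (h (c *\<^sub>R z)) \<partial>lborel) < \<infinity>"
    by (subst (asm) nn_integral_lborel_scaleR[OF _ assms(2)]) auto
  then show ?thesis
    using assms(2) by (auto simp: integrable_iff_bounded ennreal_mult_less_top)
qed

lemma integral_lborel_scaleR:
  fixes h :: "'a::euclidean_space \<Rightarrow> 'b::{banach, second_countable_topology}"
  assumes [measurable]: "h \<in> borel_measurable borel" and "0 < c"
  shows "(\<integral>z. h z \<partial>lborel) = c ^ DIM('a) *\<^sub>R (\<integral>z. h (c *\<^sub>R z) \<partial>lborel)"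
  by (subst lborel_affine[of c 0]) (use assms(2) in \<open>auto simp: integral_density integral_distr\<close>)

section \<open>Planar Lebesgue measure in coordinates: shears and rotations\<close>

lemma lborel_complex_eq:
  "(lborel :: complex measure) = distr (lborel \<Otimes>\<^sub>M lborel) borel (\<lambda>(x, y). Complex x y)"
proof (rule lborel_eqI)
  fix l u :: complex
  assume "\<And>b. b \<in> Basis \<Longrightarrow> l \<bullet> b \<le> u \<bullet> b"
  from this[of 1] this[of \<i>] have le: "Re l \<le> Re u" "Im l \<le> Im u"
    by (auto simp: Basis_complex_def inner_complex_def)
  have [measurable]: "(\<lambda>(x, y). Complex x y) \<in> borel_measurable (lborel \<Otimes>\<^sub>M lborel)"
    unfolding borel_measurable_complex_iff by (simp add: case_prod_beta)
  have "(\<lambda>(x, y). Complex x y) -` box l u \<inter> space (lborel \<Otimes>\<^sub>M lborel)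
      = {Re l<..<Re u} \<times> {Im l<..<Im u}"
    by (auto simp: box_def Basis_complex_def inner_complex_def space_pair_measure)
  then show "emeasure (distr (lborel \<Otimes>\<^sub>M lborel) borel (\<lambda>(x, y). Complex x y)) (box l u) =
      ennreal (\<Prod>b\<in>Basis. (u - l) \<bullet> b)"
    using le by (simp add: emeasure_distr lborel.emeasure_pair_measure_Times Basis_complex_def
        inner_complex_def ennreal_mult'[symmetric])
qed simp

lemma measurable_Complex [measurable (raw)]:
  "f \<in> borel_measurable M \<Longrightarrow> g \<in> borel_measurable M \<Longrightarrow> (\<lambda>x. Complex (f x) (g x)) \<in> borel_measurable M"
  unfolding borel_measurable_complex_iff by simp

lemma
  fixes h :: "complex \<Rightarrow> ennreal"
  assumes [measurable]: "h \<in> borel_measurable borel"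
  shows nn_integral_lborel_complex: "(\<integral>\<^sup>+z. h z \<partial>lborel) = (\<integral>\<^sup>+x. \<integral>\<^sup>+y. h (Complex x y) \<partial>lborel \<partial>lborel)"
    and nn_integral_lborel_complex': "(\<integral>\<^sup>+z. h z \<partial>lborel) = (\<integral>\<^sup>+y. \<integral>\<^sup>+x. h (Complex x y) \<partial>lborel \<partial>lborel)"
proof -
  have m: "(\<lambda>(x, y). Complex x y) \<in> (lborel \<Otimes>\<^sub>M lborel) \<rightarrow>\<^sub>M borel" by measurable
  have *: "(\<integral>\<^sup>+z. h z \<partial>lborel) = (\<integral>\<^sup>+(x, y). h (Complex x y) \<partial>(lborel \<Otimes>\<^sub>M lborel))"
    by (subst lborel_complex_eq, subst nn_integral_distr[OF m]) (auto simp: case_prod_beta')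
  show "(\<integral>\<^sup>+z. h z \<partial>lborel) = (\<integral>\<^sup>+x. \<integral>\<^sup>+y. h (Complex x y) \<partial>lborel \<partial>lborel)"
    unfolding * by (subst lborel.nn_integral_fst[symmetric]) auto
  show "(\<integral>\<^sup>+z. h z \<partial>lborel) = (\<integral>\<^sup>+y. \<integral>\<^sup>+x. h (Complex x y) \<partial>lborel \<partial>lborel)"
    unfolding * by (subst lborel_pair.nn_integral_snd[symmetric]) auto
qed

lemma nn_integral_lborel_shear_Re:
  fixes h :: "complex \<Rightarrow> ennreal"
  assumes [measurable]: "h \<in> borel_measurable borel"
  shows "(\<integral>\<^sup>+z. h (z + of_real (c * Im z)) \<partial>lborel) = (\<integral>\<^sup>+z. h z \<partial>lborel)"
proof -
  have "(\<integral>\<^sup>+x. h (Complex (x + c * y) y) \<partial>lborel) = (\<integral>\<^sup>+x. h (Complex x y) \<partial>lborel)" for y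
    using nn_integral_real_affine[of "\<lambda>x. h (Complex x y)" 1 "c * y"] by (simp add: add.commute)
  moreover have "Complex x y + of_real (c * y) = Complex (x + c * y) y" for x y
    by (simp add: complex_eq_iff)
  ultimately show ?thesis
    by (simp add: nn_integral_lborel_complex')
qed

lemma nn_integral_lborel_shear_Im:
  fixes h :: "complex \<Rightarrow> ennreal"
  assumes [measurable]: "h \<in> borel_measurable borel"
  shows "(\<integral>\<^sup>+z. h (z + \<i> * of_real (c * Re z)) \<partial>lborel) = (\<integral>\<^sup>+z. h z \<partial>lborel)"
proof -
  have "(\<integral>\<^sup>+y. h (Complex x (y + c * x)) \<partial>lborel) = (\<integral>\<^sup>+y. h (Complex x y) \<partial>lborel)" for x
    using nn_integral_real_affine[of "\<lambda>y. h (Complex x y)" 1 "c * x"] by (simp add: add.commute)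
  moreover have "Complex x y + \<i> * of_real (c * x) = Complex x (y + c * x)" for x y
    by (simp add: complex_eq_iff)
  ultimately show ?thesis
    by (simp add: nn_integral_lborel_complex)
qed

text \<open>A rotation by an angle other than \<open>\<pi>\<close> is a product of three shears.\<close>

lemma nn_integral_lborel_rotate:
  fixes h :: "complex \<Rightarrow> ennreal"
  assumes [measurable]: "h \<in> borel_measurable borel" and u: "norm u = 1"
  shows "(\<integral>\<^sup>+z. h (u * z) \<partial>lborel) = (\<integral>\<^sup>+z. h z \<partial>lborel)"
proof (cases "u = -1")
  case True
  show ?thesis
    unfolding True by (subst (2) lborel_affine[of "-1" 0]) (auto simp: nn_integral_density nn_integral_distr)
next
  case False
  have u2: "(Re u)\<^sup>2 + (Im u)\<^sup>2 = 1" using u by (simp add: cmod_def)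
  have "Re u \<noteq> -1"
  proof
    assume "Re u = -1"
    then have "u = -1" using u2 by (simp add: complex_eq_iff)
    then show False using False by simp
  qed
  then have nz: "1 + Re u \<noteq> 0" by linarith
  \<comment> \<open>For \<open>u\<close> of angle \<theta> this is minus the tangent of \<theta>/2,
    and the middle shear has slope sin \<theta>.\<close>
  define t where "t = - Im u / (1 + Re u)"
  let ?x = "\<lambda>z::complex. z + of_real (t * Im z)" and ?y = "\<lambda>z::complex. z + \<i> * of_real (Im u * Re z)"
  have t1: "1 + t * Im u = Re u" and t2: "t * (1 + Re u) = - Im u"
    using nz u2 by (auto simp: t_def field_simps power2_eq_square)
  have "u * z = ?x (?y (?x z))" for z
  proof -
    have "Re (?x (?y (?x z))) = (1 + t * Im u) * Re z + t * (1 + (1 + t * Im u)) * Im z"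
      by (simp add: algebra_simps)
    moreover have "Im (?x (?y (?x z))) = (1 + t * Im u) * Im z + Im u * Re z"
      by (simp add: algebra_simps)
    ultimately show ?thesis unfolding t1 t2 by (auto simp: complex_eq_iff)
  qed
  then have "(\<integral>\<^sup>+z. h (u * z) \<partial>lborel) = (\<integral>\<^sup>+z. h (?x (?y (?x z))) \<partial>lborel)" by simp
  also have "\<dots> = (\<integral>\<^sup>+z. h (?x (?y z)) \<partial>lborel)"
    by (rule nn_integral_lborel_shear_Re[of "\<lambda>z. h (?x (?y z))"]) measurable
  also have "\<dots> = (\<integral>\<^sup>+z. h (?x z) \<partial>lborel)"
    by (rule nn_integral_lborel_shear_Im[of "\<lambda>z. h (?x z)"]) measurable
  also have "\<dots> = (\<integral>\<^sup>+z. h z \<partial>lborel)"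
    by (rule nn_integral_lborel_shear_Re) measurable
  finally show ?thesis .
qed

section \<open>Circle means\<close>

lemma continuous_on_norm_powr:
  fixes f :: "'a::topological_space \<Rightarrow> 'b::real_normed_vector" and p :: real
  assumes "continuous_on S f" "1 \<le> p"
  shows "continuous_on S (\<lambda>x. norm (f x) powr p)"
  using assms by (intro continuous_on_powr' continuous_intros) auto

text \<open>By periodicity the piece of the shifted interval beyond 2\<pi> folds back to the start.
  Hence the mean of \<open>h (z * cis t)\<close> over t depends on z only through its
  modulus.\<close>

lemma integral_circle_shift:
  fixes h :: "complex \<Rightarrow> real"
  assumes h: "continuous_on (sphere 0 s) h" and s: "0 \<le> s" and a: "0 \<le> a" "a \<le> 2 * pi"
  shows "integral {0..2*pi} (\<lambda>t. h (of_real s * cis (a + t))) = integral {0..2*pi} (\<lambda>t. h (of_real s * cis t))"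
proof -
  define k where "k = (\<lambda>t. h (of_real s * cis t))"
  have cont: "continuous_on A k" for A
    unfolding k_def
    by (rule continuous_on_compose2[OF h]) (use s in \<open>auto intro!: continuous_intros simp: norm_mult\<close>)
  have int: "k integrable_on {c..d}" for c d
    by (intro integrable_continuous_real cont)
  have per: "k (2 * pi + t) = k t" for t
    by (simp add: k_def cis_mult[symmetric])
  have "integral {0..2*pi} (\<lambda>t. k (a + t)) = integral {a..2*pi+a} k"
    using integral_shift[of 0 a "2*pi" k] cont by (simp add: o_def add.commute)
  also have "\<dots> = integral {a..2*pi} k + integral {2*pi..2*pi+a} k"
    using a by (intro Henstock_Kurzweil_Integration.integral_combine[symmetric] int) auto
  also have "integral {2*pi..2*pi+a} k = integral {0..a} (\<lambda>t. k (2*pi + t))"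
    using integral_shift[of 0 "2*pi" a k] cont by (simp add: o_def add.commute)
  also have "integral {0..a} (\<lambda>t. k (2*pi + t)) = integral {0..a} k"
    unfolding per ..
  also have "integral {a..2*pi} k + integral {0..a} k = integral {0..2*pi} k"
    using Henstock_Kurzweil_Integration.integral_combine[OF a int] by simp
  finally show ?thesis unfolding k_def .
qed

text \<open>The regularized dual function \<open>conj w (|w| + \<epsilon>) powr (p - 2)\<close>, with \<open>w\<close> the values of \<open>f\<close>
  on the inner circle, stays continuous at the zeros of \<open>f\<close> also when \<open>p = 1\<close>. Paired with the rotated dilations
  \<open>f (z cis t)\<close> it gives a holomorphic function of \<open>z\<close>, to which the maximum principle applies.\<close>

lemma circle_mean_mono:
  fixes f :: "complex \<Rightarrow> complex" and p r s :: real
  assumes hol: "f holomorphic_on ball 0 1" and p: "1 \<le> p" and rs: "0 \<le> r" "r < s" "s < 1"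
  shows "integral {0..2*pi} (\<lambda>t. norm (f (of_real r * cis t)) powr p)
       \<le> integral {0..2*pi} (\<lambda>t. norm (f (of_real s * cis t)) powr p)"
proof -
  define w where "w t = f (of_real r * cis t)" for t
  define M where "M q = integral {0..2*pi} (\<lambda>t. norm (f (of_real q * cis t)) powr p)" for q
  note contf = holomorphic_on_imp_continuous_on[OF hol]
  have cw: "continuous_on {0..2*pi} w"
    unfolding w_def by (rule continuous_on_compose2[OF contf])
      (use rs in \<open>auto intro!: continuous_intros simp: norm_mult\<close>)
  have contM: "continuous_on {0..2*pi} (\<lambda>t. f (z * cis t))" if "norm z < 1" for z
    by (rule continuous_on_compose2[OF contf]) (use that in \<open>auto intro!: continuous_intros simp: norm_mult\<close>)
  have "bounded (w ` {0..2*pi})"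
    by (intro compact_imp_bounded compact_continuous_image cw) auto
  then obtain B where B: "\<And>t. t \<in> {0..2*pi} \<Longrightarrow> norm (w t) \<le> B"
    unfolding bounded_iff by blast
  \<comment> \<open>The error is \<open>2 * e * (B + 1) powr (p - 1)\<close> pointwise, times the
    length 2\<pi>, times \<open>p\<close> when the fraction \<open>(p - 1) / p\<close> of
    \<open>N\<close> is absorbed.\<close>
  have main: "M r \<le> M s + e * (4 * pi * p * (B + 1) powr (p - 1))" if e: "0 < e" "e \<le> 1" for e
  proof -
    define c where "c t = cnj (w t) * of_real ((norm (w t) + e) powr (p - 2))" for t
    define N where "N = integral {0..2*pi} (\<lambda>t. (norm (w t) + e) powr p)"
    define \<Phi> where "\<Phi> z = integral {0..2*pi} (\<lambda>t. c t * f (z * cis t))" for z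
    have pos: "0 < norm (w t) + e" for t using e norm_ge_zero[of "w t"] by linarith
    have ne: "norm (w t) + e \<noteq> 0" for t using pos[of t] by simp
    have ce: "continuous_on {0..2*pi} (\<lambda>t. (norm (w t) + e) powr q)" for q
      using cw ne by (intro continuous_intros) auto
    have cc: "continuous_on {0..2*pi} c"
      unfolding c_def by (intro continuous_intros cw ce)
    have holo: "\<Phi> holomorphic_on ball 0 1"
      unfolding \<Phi>_def interval_cbox
    proof (rule leibniz_rule_holomorphic[where fx = "\<lambda>z t. c t * (deriv f (z * cis t) * cis t)"])
      fix z :: complex and t :: real assume z: "z \<in> ball 0 1"
      then have "(f has_field_derivative deriv f (z * cis t)) (at (z * cis t))"
        by (intro holomorphic_derivI[OF hol]) (auto simp: norm_mult)
      then show "((\<lambda>z. c t * f (z * cis t)) has_field_derivative c t * (deriv f (z * cis t) * cis t)) (at z within ball 0 1)"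
        by (auto intro!: derivative_eq_intros DERIV_chain2[of f] simp: has_field_derivative_at_within)
    next
      fix z :: complex assume "z \<in> ball 0 1"
      then show "(\<lambda>t. c t * f (z * cis t)) integrable_on cbox 0 (2 * pi)"
        using cc contM[of z] by (intro integrable_continuous continuous_intros) auto
    next
      let ?S = "ball 0 1 \<times> cbox 0 (2 * pi) :: (complex \<times> real) set"
      have "continuous_on (ball 0 1) (deriv f)"
        using hol by (intro holomorphic_on_imp_continuous_on holomorphic_deriv) auto
      then have "continuous_on ?S (\<lambda>x. deriv f (fst x * cis (snd x)))"
        by (rule continuous_on_compose2) (auto intro!: continuous_intros simp: norm_mult)
      moreover have "continuous_on ?S (\<lambda>x. c (snd x))"
        by (rule continuous_on_compose2[OF cc]) (auto intro!: continuous_intros)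
      ultimately show "continuous_on ?S (\<lambda>(z, t). c t * (deriv f (z * cis t) * cis t))"
        unfolding case_prod_beta' by (intro continuous_on_mult continuous_on_cis continuous_on_snd continuous_on_id)
    qed auto
    \<comment> \<open>The mean of \<open>norm (f (z * cis t)) powr p\<close> is the same number
      \<open>M s\<close> at every z of the outer circle. Young's inequality, with
      \<open>norm (c t)\<close> at most the power \<open>p - 1\<close> of
      \<open>norm (w t) + e\<close>, thus gives one bound on the whole frontier.\<close>
    have le: "norm (\<Phi> z) \<le> (p - 1) / p * N + 1 / p * M s" if z: "norm z = s" for z
    proof -
      define a where "a = Arg2pi z"
      have za: "z = of_real s * cis a" and a: "0 \<le> a" "a \<le> 2 * pi"
        using Arg2pi[of z] z by (auto simp: a_def cis_conv_exp is_Arg_def)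
      have cz: "continuous_on {0..2*pi} (\<lambda>t. norm (f (z * cis t)) powr p)"
        using contM[of z] z rs p by (intro continuous_on_norm_powr) auto
      have nc: "norm (c t) \<le> (norm (w t) + e) powr (p - 1)" for t
      proof -
        have "norm (c t) = norm (w t) * (norm (w t) + e) powr (p - 2)"
          by (simp add: c_def norm_mult)
        also have "\<dots> \<le> (norm (w t) + e) * (norm (w t) + e) powr (p - 2)"
          using e by (intro mult_right_mono) auto
        also have "\<dots> = (norm (w t) + e) powr (p - 1)"
          using pos[of t] by (simp add: powr_diff power2_eq_square)
        finally show ?thesis .
      qed
      have "norm (\<Phi> z) \<le> integral {0..2*pi} (\<lambda>t. (p - 1) / p * (norm (w t) + e) powr p + 1 / p * norm (f (z * cis t)) powr p)"
        unfolding \<Phi>_def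
      proof (rule integral_norm_bound_integral)
        show "(\<lambda>t. c t * f (z * cis t)) integrable_on {0..2*pi}"
          using z rs by (intro integrable_continuous_real continuous_on_mult cc contM) auto
        show "(\<lambda>t. (p - 1) / p * (norm (w t) + e) powr p + 1 / p * norm (f (z * cis t)) powr p) integrable_on {0..2*pi}"
          by (intro integrable_continuous_real continuous_on_add continuous_on_mult continuous_on_const ce cz)
        fix t :: real
        have "norm (c t * f (z * cis t)) \<le> (norm (w t) + e) powr (p - 1) * norm (f (z * cis t))"
          unfolding norm_mult by (intro mult_right_mono nc) auto
        also have "\<dots> \<le> (p - 1) / p * (norm (w t) + e) powr p + 1 / p * norm (f (z * cis t)) powr p"
          using pos[of t] p by (intro young_powr) auto
        finally show "norm (c t * f (z * cis t)) \<le> \<dots>" .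
      qed
      also have "\<dots> = (p - 1) / p * N + 1 / p * integral {0..2*pi} (\<lambda>t. norm (f (z * cis t)) powr p)"
        unfolding N_def
        by (subst integral_add)
          (intro integrable_continuous_real continuous_on_mult continuous_on_const ce cz | simp)+
      also have "integral {0..2*pi} (\<lambda>t. norm (f (z * cis t)) powr p) = M s"
      proof -
        have "continuous_on (sphere 0 s) (\<lambda>z. norm (f z) powr p)"
          using p rs by (intro continuous_on_norm_powr continuous_on_subset[OF contf]) auto
        then show ?thesis
          using integral_circle_shift[of s "\<lambda>z. norm (f z) powr p" a] a rs
          by (simp add: za M_def mult.assoc cis_mult)
      qed
      finally show ?thesis .
    qed
    \<comment> \<open>The maximum principle carries the bound inward to the real point
      \<open>r\<close>, where \<Phi> pairs \<open>w\<close> with its own dual function.\<close>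
    have "norm (\<Phi> (of_real r)) \<le> (p - 1) / p * N + 1 / p * M s"
    proof (rule maximum_modulus_frontier[of \<Phi> "ball 0 s"])
      show "\<Phi> holomorphic_on interior (ball 0 s)"
        using rs by (intro holomorphic_on_subset[OF holo]) auto
      show "continuous_on (closure (ball 0 s)) \<Phi>"
        using rs by (intro continuous_on_subset[OF holomorphic_on_imp_continuous_on[OF holo]]) auto
    qed (use rs le in auto)
    moreover have "N - e * (4 * pi * (B + 1) powr (p - 1)) \<le> norm (\<Phi> (of_real r))"
    proof -
      \<comment> \<open>With v = |w| + e one has |w|^2 = (v - e)^2, which is at least v^2 - 2ev.
        After multiplication by v^(p-2) the loss is 2e v^(p-1), and v is at most
        \<open>B + 1\<close> because \<open>e\<close> is at most 1.\<close>
      have ptw: "(norm (w t) + e) powr p - 2 * e * (B + 1) powr (p - 1) \<le> (norm (w t))\<^sup>2 * (norm (w t) + e) powr (p - 2)"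
        if t: "t \<in> {0..2*pi}" for t
      proof -
        let ?v = "norm (w t) + e"
        have v: "?v powr p = ?v\<^sup>2 * ?v powr (p - 2)" "?v powr (p - 1) = ?v * ?v powr (p - 2)"
          using pos[of t] by (auto simp: powr_diff power2_eq_square)
        have "?v powr p - 2 * e * (B + 1) powr (p - 1) \<le> ?v powr p - 2 * e * ?v powr (p - 1)"
          using B[OF t] e p pos[of t] by (intro diff_left_mono mult_left_mono powr_mono2) auto
        also have "\<dots> = (?v\<^sup>2 - 2 * e * ?v) * ?v powr (p - 2)"
          unfolding v by (simp add: algebra_simps)
        also have "\<dots> \<le> (norm (w t))\<^sup>2 * ?v powr (p - 2)"
          using e by (intro mult_right_mono) (auto simp: power2_eq_square algebra_simps)
        finally show ?thesis .
      qed
      have "N - e * (4 * pi * (B + 1) powr (p - 1)) = integral {0..2*pi} (\<lambda>t. (norm (w t) + e) powr p - 2 * e * (B + 1) powr (p - 1))"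
        unfolding N_def
        by (subst integral_diff) (intro integrable_continuous_real continuous_on_const ce | simp)+
      also have "\<dots> \<le> integral {0..2*pi} (\<lambda>t. (norm (w t))\<^sup>2 * (norm (w t) + e) powr (p - 2))"
        by (intro integral_le ptw integrable_continuous_real continuous_on_diff continuous_on_mult
            continuous_on_power continuous_on_norm continuous_on_const ce cw)
      also have "\<dots> = norm (of_real \<dots> :: complex)"
        unfolding norm_of_real
        by (intro abs_of_nonneg[symmetric] integral_nonneg integrable_continuous_real continuous_on_mult
            continuous_on_power continuous_on_norm ce cw) auto
      also have "of_real (integral {0..2*pi} (\<lambda>t. (norm (w t))\<^sup>2 * (norm (w t) + e) powr (p - 2))) = \<Phi> (of_real r)"
      proof -
        have "c t * f (of_real r * cis t) = of_real ((norm (w t))\<^sup>2 * (norm (w t) + e) powr (p - 2))" for t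
          unfolding of_real_mult complex_norm_square c_def w_def[symmetric] by (simp only: mult_ac)
        then show ?thesis
          unfolding \<Phi>_def
          by (subst integral_linear[OF _ bounded_linear_of_real, unfolded o_def, symmetric])
            (intro integrable_continuous_real continuous_on_mult continuous_on_power continuous_on_norm ce cw | simp)+
      qed
      finally show ?thesis .
    qed
    ultimately have "N - e * (4 * pi * (B + 1) powr (p - 1)) \<le> (p - 1) / p * N + 1 / p * M s" by linarith
    \<comment> \<open>After multiplication by \<open>p\<close> the term \<open>(p - 1) * N\<close>
      cancels and one \<open>N\<close> survives, so the means are compared directly and no p-th
      roots appear.\<close>
    then have "p * (N - e * (4 * pi * (B + 1) powr (p - 1))) \<le> p * ((p - 1) / p * N + 1 / p * M s)"
      using p by (intro mult_left_mono) auto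
    also have "\<dots> = (p - 1) * N + M s" using p by (simp add: distrib_left)
    finally have "N \<le> M s + e * (4 * pi * p * (B + 1) powr (p - 1))" by (simp add: algebra_simps)
    moreover have "M r \<le> N"
      unfolding M_def N_def w_def[symmetric]
      using p e by (intro integral_le integrable_continuous_real continuous_on_norm_powr cw ce powr_mono2) auto
    ultimately show ?thesis by linarith
  qed
  define K where "K = 4 * pi * p * (B + 1) powr (p - 1)"
  have "0 \<le> K" using p by (simp add: K_def)
  have "M r \<le> M s"
  proof (rule field_le_epsilon)
    fix d :: real assume d: "0 < d"
    define e where "e = min 1 (d / (K + 1))"
    have e: "0 < e" "e \<le> 1" using d \<open>0 \<le> K\<close> by (auto simp: e_def)
    have "e * K \<le> d / (K + 1) * K" using \<open>0 \<le> K\<close> by (intro mult_right_mono) (auto simp: e_def)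
    also have "\<dots> \<le> d" using \<open>0 \<le> K\<close> d by (simp add: field_simps)
    finally show "M r \<le> M s + d" using main[OF e] by (simp add: K_def)
  qed
  then show ?thesis by (simp add: M_def)
qed

text \<open>Rotations replace polar coordinates. For \<open>w\<close> in the annulus the integral of
  \<open>h (cis t * w)\<close> over t is the circle mean of radius |w|, which dominates the one of
  radius \<open>r\<close>. Integrate over \<open>w\<close> and exchange the order: rotation
  invariance makes the inner integral independent of t, whence the factor 2\<pi>.\<close>

lemma circle_mean_le_annulus:
  fixes f :: "complex \<Rightarrow> complex" and p r :: real
  assumes hol: "f holomorphic_on ball 0 1" and p: "1 \<le> p" and r: "0 \<le> r" "r < 1"
  defines "A \<equiv> {z::complex. r < norm z \<and> norm z < 1}"
  shows "ennreal (integral {0..2*pi} (\<lambda>t. norm (f (of_real r * cis t)) powr p)) * emeasure lborel A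
       \<le> ennreal (2 * pi) * (\<integral>\<^sup>+z. indicator A z * ennreal (norm (f z) powr p) \<partial>lborel)"
proof -
  define M where "M q = integral {0..2*pi} (\<lambda>t. norm (f (of_real q * cis t)) powr p)" for q
  define F where "F z = indicator (ball 0 1) z *\<^sub>R f z" for z
  define h where "h z = indicator A z * ennreal (norm (F z) powr p)" for z
  note contf = holomorphic_on_imp_continuous_on[OF hol]
  have [measurable]: "F \<in> borel_measurable borel"
    unfolding F_def by (intro borel_measurable_continuous_on_indicator contf) auto
  have [measurable]: "A \<in> sets borel" unfolding A_def by measurable
  have [measurable]: "h \<in> borel_measurable borel" unfolding h_def by measurable
  have hA: "indicator A z * ennreal (norm (f z) powr p) = h z" for z
    by (auto simp: h_def F_def A_def indicator_def)
  have circ: "indicator A w * ennreal (M r) \<le> (\<integral>\<^sup>+t. indicator {0..2*pi} t * h (cis t * w) \<partial>lborel)" for w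
  proof (cases "w \<in> A")
    case True
    define s where "s = norm w"
    define a where "a = Arg2pi w"
    have w: "w = of_real s * cis a" and a: "0 \<le> a" "a \<le> 2 * pi"
      using Arg2pi[of w] by (auto simp: a_def s_def cis_conv_exp is_Arg_def)
    have s: "r < s" "s < 1" using True by (auto simp: A_def s_def)
    have cz: "continuous_on {0..2*pi} (\<lambda>t. norm (f (cis t * w)) powr p)"
      using s p by (intro continuous_on_norm_powr continuous_on_compose2[OF contf])
        (auto intro!: continuous_intros simp: norm_mult s_def)
    have Meq: "integral {0..2*pi} (\<lambda>t. norm (f (cis t * w)) powr p) = M s"
    proof -
      have "continuous_on (sphere 0 s) (\<lambda>z. norm (f z) powr p)"
        using p s r by (intro continuous_on_norm_powr continuous_on_subset[OF contf]) auto
      moreover have "cis t * w = of_real s * cis (a + t)" for t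
        by (simp add: w cis_mult[symmetric])
      ultimately show ?thesis
        using integral_circle_shift[of s "\<lambda>z. norm (f z) powr p" a] a s r by (simp add: M_def)
    qed
    have "(\<integral>\<^sup>+t. indicator {0..2*pi} t * h (cis t * w) \<partial>lborel)
        = (\<integral>\<^sup>+t. ennreal (indicator {0..2*pi} t * norm (F (cis t * w)) powr p) \<partial>lborel)"
      using True by (intro nn_integral_cong) (auto simp: h_def A_def norm_mult indicator_def)
    also have "\<dots> = (\<integral>\<^sup>+t. ennreal (norm (F (cis t * w)) powr p) * indicator {0..2*pi} t \<partial>lborel)"
      by (intro nn_integral_cong) (auto simp: indicator_def)
    also have "\<dots> = ennreal (M s)"
    proof (rule nn_integral_has_integral_lebesgue')
      have "((\<lambda>t. norm (f (cis t * w)) powr p) has_integral M s) {0..2*pi}"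
        using integrable_continuous_real[OF cz] Meq by (metis integrable_integral)
      then show "((\<lambda>t. norm (F (cis t * w)) powr p) has_integral M s) {0..2*pi}"
        using s by (simp add: F_def norm_mult s_def)
    qed auto
    finally show ?thesis
      using circle_mean_mono[OF hol p r(1) s] True by (simp add: M_def ennreal_leI)
  qed auto
  have "ennreal (M r) * emeasure lborel A = (\<integral>\<^sup>+w. indicator A w * ennreal (M r) \<partial>lborel)"
    using nn_integral_cmult_indicator[of A lborel "ennreal (M r)"] by (simp add: mult.commute)
  also have "\<dots> \<le> (\<integral>\<^sup>+w. \<integral>\<^sup>+t. indicator {0..2*pi} t * h (cis t * w) \<partial>lborel \<partial>lborel)"
    by (intro nn_integral_mono circ)
  also have "\<dots> = (\<integral>\<^sup>+t. \<integral>\<^sup>+w. indicator {0..2*pi} t * h (cis t * w) \<partial>lborel \<partial>lborel)"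
  proof (rule lborel_pair.Fubini')
    have [measurable]: "(\<lambda>t. cis t) \<in> borel_measurable borel"
      by (intro borel_measurable_continuous_onI continuous_intros)
    have "(\<lambda>x. cis (fst x) * snd x) \<in> borel_measurable ((lborel::real measure) \<Otimes>\<^sub>M (lborel::complex measure))"
      by (intro borel_measurable_times) measurable
    then have "(\<lambda>x. h (cis (fst x) * snd x)) \<in> borel_measurable ((lborel::real measure) \<Otimes>\<^sub>M (lborel::complex measure))"
      by (rule measurable_compose) fact
    then show "(\<lambda>(t, w). indicator {0..2*pi} t * h (cis t * w)) \<in> borel_measurable (lborel \<Otimes>\<^sub>M lborel)"
      unfolding case_prod_beta' by (rule borel_measurable_times_ennreal[rotated]) measurable
  qed
  also have "\<dots> = (\<integral>\<^sup>+t. indicator {0..2*pi::real} t * (\<integral>\<^sup>+w. h w \<partial>lborel) \<partial>lborel)"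
    by (intro nn_integral_cong) (simp add: nn_integral_cmult nn_integral_lborel_rotate)
  also have "\<dots> = ennreal (2 * pi) * (\<integral>\<^sup>+w. h w \<partial>lborel)"
    by (simp add: nn_integral_multc)
  finally show ?thesis by (simp add: hA M_def)
qed

section \<open>Smooth functions with compact support\<close>

text \<open>One-variable counterpart of \<open>C_k\<close>. The derivative is quantified
  existentially, so each closure property is proved by exhibiting a derivative and applying the
  induction hypothesis to it.\<close>

primrec diff_k :: "nat \<Rightarrow> (real \<Rightarrow> real) \<Rightarrow> bool" where
  "diff_k 0 u \<longleftrightarrow> continuous_on UNIV u"
| "diff_k (Suc k) u \<longleftrightarrow> (\<exists>u'. (\<forall>x. (u has_real_derivative u' x) (at x)) \<and> diff_k k u')"

definition smooth :: "(real \<Rightarrow> real) \<Rightarrow> bool" where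
  "smooth u \<longleftrightarrow> (\<forall>k. diff_k k u)"

lemma diff_k_SucI: "(\<And>x. (u has_real_derivative u' x) (at x)) \<Longrightarrow> diff_k k u' \<Longrightarrow> diff_k (Suc k) u"
  by auto

text \<open>Needed for the product rule: the undifferentiated factors in u' v + v' u come with one
  order more than the induction hypothesis is applied with.\<close>

lemma diff_k_Suc_imp: "diff_k (Suc k) u \<Longrightarrow> diff_k k u"
proof (induction k arbitrary: u)
  case 0
  then show ?case
    by (auto intro!: continuous_at_imp_continuous_on intro: DERIV_isCont)
next
  case (Suc k)
  then show ?case by (metis diff_k.simps(2))
qed

lemma diff_k_const: "diff_k k (\<lambda>_. c)"
proof (induction k arbitrary: c)
  case (Suc k)
  show ?case using Suc[of 0] by (intro diff_k_SucI[of _ "\<lambda>_. 0"]) auto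
qed simp

lemma diff_k_add: "diff_k k u \<Longrightarrow> diff_k k v \<Longrightarrow> diff_k k (\<lambda>x. u x + v x)"
proof (induction k arbitrary: u v)
  case (Suc k)
  then obtain u' v' where "\<forall>x. (u has_real_derivative u' x) (at x)" "\<forall>x. (v has_real_derivative v' x) (at x)"
    "diff_k k u'" "diff_k k v'" by auto
  then show ?case using Suc.IH[of u' v']
    by (auto intro!: exI[of _ "\<lambda>x. u' x + v' x"] derivative_intros)
qed (auto intro: continuous_intros)

lemma diff_k_mult: "diff_k k u \<Longrightarrow> diff_k k v \<Longrightarrow> diff_k k (\<lambda>x. u x * v x)"
proof (induction k arbitrary: u v)
  case (Suc k)
  then obtain u' v' where "\<forall>x. (u has_real_derivative u' x) (at x)" "\<forall>x. (v has_real_derivative v' x) (at x)"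
    "diff_k k u'" "diff_k k v'" by auto
  then show ?case
    using diff_k_add[OF Suc.IH[of u' v] Suc.IH[of v' u]] diff_k_Suc_imp[OF Suc.prems(1)] diff_k_Suc_imp[OF Suc.prems(2)]
    by (auto intro!: exI[of _ "\<lambda>x. u' x * v x + v' x * u x"] derivative_intros)
qed (auto intro: continuous_intros)

lemma diff_k_affine: "diff_k k u \<Longrightarrow> diff_k k (\<lambda>x. u (a * x + b))"
proof (induction k arbitrary: u)
  case 0
  then show ?case by (auto intro!: continuous_on_compose2[of UNIV u] continuous_intros)
next
  case (Suc k)
  then obtain u' where u': "\<forall>x. (u has_real_derivative u' x) (at x)" "diff_k k u'" by auto
  have "((\<lambda>x. u (a * x + b)) has_real_derivative u' (a * x + b) * a) (at x)" for x
    using u' by (auto intro!: derivative_eq_intros DERIV_chain2[of u])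
  then show ?case
    using diff_k_mult[OF Suc.IH[OF u'(2)] diff_k_const[of _ a]] by (rule diff_k_SucI)
qed

lemma diff_k_id: "diff_k k (\<lambda>x. x)"
proof (cases k)
  case (Suc n)
  then show ?thesis using diff_k_const[of n 1] by (auto intro!: diff_k_SucI[of _ "\<lambda>_. 1"] simp del: diff_k.simps)
qed simp

lemma smooth_mult: "smooth u \<Longrightarrow> smooth v \<Longrightarrow> smooth (\<lambda>x. u x * v x)"
  and smooth_affine: "smooth u \<Longrightarrow> smooth (\<lambda>x. u (a * x + b))"
  and smooth_id: "smooth (\<lambda>x. x)"
  by (simp_all add: smooth_def diff_k_mult diff_k_affine diff_k_id)

text \<open>Derivatives are unique, so the witnesses hidden in \<open>diff_k\<close> for the various
  orders are all the same function \<open>deriv u\<close>.\<close>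

lemma smooth_deriv:
  assumes "smooth u"
  shows "(u has_real_derivative deriv u x) (at x)" "smooth (deriv u)"
proof -
  have *: "diff_k (Suc k) u" for k using assms by (auto simp: smooth_def)
  have eq: "deriv u = u'" if "\<forall>x. (u has_real_derivative u' x) (at x)" for u'
    using that by (auto intro!: ext DERIV_imp_deriv)
  show "smooth (deriv u)" unfolding smooth_def using * eq by auto
  show "(u has_real_derivative deriv u x) (at x)" using *[of 0] eq by auto
qed

lemma smooth_continuous: "smooth u \<Longrightarrow> continuous_on A u"
  unfolding smooth_def using continuous_on_subset[of UNIV u A] by (metis diff_k.simps(1) subset_UNIV)

text \<open>Polynomials in \<open>1/x\<close> times \<open>exp (-1/x)\<close>, extended by zero to the left, form a family closed under
  differentiation.\<close>

definition flat_poly :: "real poly \<Rightarrow> real \<Rightarrow> real" where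
  "flat_poly P x = (if 0 < x then poly P (1 / x) * exp (- (1 / x)) else 0)"

lemma poly_exp_tendsto_0: "((\<lambda>y. poly P y * exp (- y)) \<longlongrightarrow> (0::real)) at_top"
proof -
  have "((\<lambda>y. coeff P i * (y ^ i / exp y)) \<longlongrightarrow> coeff P i * 0) at_top" for i
    by (intro tendsto_intros tendsto_power_div_exp_0)
  then have "((\<lambda>y. \<Sum>i\<le>degree P. coeff P i * (y ^ i / exp y)) \<longlongrightarrow> (\<Sum>i\<le>degree P. coeff P i * 0)) at_top"
    by (intro tendsto_sum)
  then show ?thesis
    by (simp add: poly_altdef exp_minus sum_distrib_right field_simps sum_divide_distrib)
qed

text \<open>With y = 1/x, differentiating P(y) exp(-y) gives y^2 (P(y) - P'(y)) exp(-y), which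
  explains the factor \<open>[:0, 0, 1:]\<close>. At the origin the exponential beats every
  polynomial in y.\<close>

lemma has_derivative_flat_poly:
  "(flat_poly P has_real_derivative flat_poly ([:0, 0, 1:] * (P - pderiv P)) x) (at x)"
proof -
  consider "0 < x" | "x < 0" | "x = 0" by linarith
  then show ?thesis
  proof cases
    case 1
    have "((\<lambda>x. poly P (1 / x) * exp (- (1 / x))) has_real_derivative
        poly ([:0, 0, 1:] * (P - pderiv P)) (1 / x) * exp (- (1 / x))) (at x)"
      using 1 by (auto intro!: derivative_eq_intros DERIV_chain2[OF poly_DERIV]
          simp: field_simps power2_eq_square)
    then have "(flat_poly P has_real_derivative poly ([:0, 0, 1:] * (P - pderiv P)) (1 / x) * exp (- (1 / x))) (at x)"
      by (rule has_field_derivative_transform_within_open[of _ _ _ "{0<..}"])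
        (use 1 in \<open>auto simp: flat_poly_def\<close>)
    then show ?thesis using 1 by (simp add: flat_poly_def)
  next
    case 2
    have "((\<lambda>_. 0) has_real_derivative 0) (at x)" by simp
    then have "(flat_poly P has_real_derivative 0) (at x)"
      by (rule has_field_derivative_transform_within_open[of _ _ _ "{..<0}"])
        (use 2 in \<open>auto simp: flat_poly_def\<close>)
    then show ?thesis using 2 by (simp add: flat_poly_def)
  next
    case 3
    have "((\<lambda>h. flat_poly P h / h) \<longlongrightarrow> 0) (at_right 0)"
    proof -
      \<comment> \<open>Dividing by h multiplies by y = 1/h, that is, replaces \<open>P\<close> by
        \<open>pCons 0 P\<close>.\<close>
      have "((\<lambda>h. poly (pCons 0 P) (inverse h) * exp (- inverse h)) \<longlongrightarrow> (0::real)) (at_right 0)"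
        by (rule filterlim_compose[OF poly_exp_tendsto_0 filterlim_inverse_at_top_right])
      moreover have "\<forall>\<^sub>F h in at_right 0. flat_poly P h / h = poly (pCons 0 P) (inverse h) * exp (- inverse h)"
        by (auto simp: eventually_at_filter flat_poly_def field_simps intro!: always_eventually)
      ultimately show ?thesis by (simp add: filterlim_cong)
    qed
    moreover have "((\<lambda>h. flat_poly P h / h) \<longlongrightarrow> 0) (at_left 0)"
    proof -
      have "\<forall>\<^sub>F h in at_left 0. flat_poly P h / h = 0"
        by (auto simp: eventually_at_filter flat_poly_def intro!: always_eventually)
      then show ?thesis by (rule tendsto_eventually)
    qed
    ultimately have "((\<lambda>h. flat_poly P h / h) \<longlongrightarrow> 0) (at 0)"
      by (rule filterlim_split_at[rotated])
    then show ?thesis using 3 by (simp add: DERIV_def flat_poly_def)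
  qed
qed

lemma smooth_flat_poly: "smooth (flat_poly P)"
proof -
  have "diff_k k (flat_poly P)" for k
  proof (induction k arbitrary: P)
    case 0
    then show ?case
      using has_derivative_flat_poly by (auto intro!: continuous_at_imp_continuous_on DERIV_isCont)
  next
    case (Suc k)
    then show ?case using has_derivative_flat_poly by auto
  qed
  then show ?thesis by (simp add: smooth_def)
qed

text \<open>The factor \<open>flat_poly 1\<close> is exp(-1/x) on the positive axis. Stretching its
  argument by \<open>Suc n\<close> pushes both factors to 1 inside the interval without enlarging
  the support, so indicators of intervals are approached by test functions directly.\<close>

definition bump :: "nat \<Rightarrow> real \<Rightarrow> real \<Rightarrow> real \<Rightarrow> real" where
  "bump n a b x = flat_poly 1 (real (Suc n) * (x - a)) * flat_poly 1 (real (Suc n) * (b - x))"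

lemma smooth_bump: "smooth (bump n a b)"
proof -
  let ?m = "real (Suc n)"
  have "bump n a b = (\<lambda>x. flat_poly 1 (?m * x + (- ?m * a)) * flat_poly 1 ((- ?m) * x + ?m * b))"
    by (auto simp: bump_def algebra_simps)
  then show ?thesis by (simp only: smooth_mult smooth_affine smooth_flat_poly)
qed

lemma bump_bounds: "0 \<le> bump n a b x" "bump n a b x \<le> 1"
  by (auto simp: bump_def flat_poly_def intro!: mult_le_one)

lemma bump_eq_0: "x \<notin> {a<..<b} \<Longrightarrow> bump n a b x = 0"
  by (auto simp: bump_def flat_poly_def zero_less_mult_iff)

lemma bump_tendsto: "(\<lambda>n. bump n a b x) \<longlonglongrightarrow> indicator {a<..<b} x"
proof (cases "x \<in> {a<..<b}")
  case True
  have *: "(\<lambda>n. flat_poly 1 (real (Suc n) * y)) \<longlonglongrightarrow> 1" if "0 < y" for y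
  proof -
    have "(\<lambda>n. exp (- (inverse (real (Suc n)) * inverse y))) \<longlonglongrightarrow> exp (- (0 * inverse y))"
      by (intro tendsto_intros LIMSEQ_inverse_real_of_nat)
    then show ?thesis using that by (simp add: flat_poly_def zero_less_mult_iff inverse_eq_divide)
  qed
  show ?thesis
    unfolding bump_def using True tendsto_mult[OF *[of "x - a"] *[of "b - x"]] by simp
qed (simp add: bump_eq_0)

section \<open>Products of one-variable functions as test functions on the disk\<close>

lemma has_derivative_tensor:
  assumes "(u has_real_derivative u') (at (Re z))" "(v has_real_derivative v') (at (Im z))"
  shows "((\<lambda>z. u (Re z) * v (Im z)) has_derivative (\<lambda>h. u' * v (Im z) * Re h + u (Re z) * v' * Im h)) (at z)"
proof -
  have "((\<lambda>z. u (Re z)) has_derivative (\<lambda>h. u' * Re h)) (at z)"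
    using has_derivative_compose[OF has_derivative_Re[OF has_derivative_ident], of u _ z UNIV] assms(1)
    by (simp add: has_field_derivative_def)
  moreover have "((\<lambda>z. v (Im z)) has_derivative (\<lambda>h. v' * Im h)) (at z)"
    using has_derivative_compose[OF has_derivative_Im[OF has_derivative_ident], of v _ z UNIV] assms(2)
    by (simp add: has_field_derivative_def)
  ultimately show ?thesis
    by (rule has_derivative_eq_rhs[OF has_derivative_mult]) (auto simp: algebra_simps)
qed

lemma
  assumes "smooth u" "smooth v"
  shows differentiable_tensor: "(\<lambda>z. u (Re z) * v (Im z)) differentiable (at z)"
    and dir_deriv_tensor_1: "dir_deriv (\<lambda>z. u (Re z) * v (Im z)) 1 = (\<lambda>z. deriv u (Re z) * v (Im z))"
    and dir_deriv_tensor_ii: "dir_deriv (\<lambda>z. u (Re z) * v (Im z)) \<i> = (\<lambda>z. u (Re z) * deriv v (Im z))"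
proof -
  note d = has_derivative_tensor[OF smooth_deriv(1)[OF assms(1)] smooth_deriv(1)[OF assms(2)]]
  show "(\<lambda>z. u (Re z) * v (Im z)) differentiable (at z)"
    using d by (rule differentiableI)
  show "dir_deriv (\<lambda>z. u (Re z) * v (Im z)) 1 = (\<lambda>z. deriv u (Re z) * v (Im z))"
    "dir_deriv (\<lambda>z. u (Re z) * v (Im z)) \<i> = (\<lambda>z. u (Re z) * deriv v (Im z))"
    by (simp_all add: frechet_derivative_at[OF d, symmetric])
qed

text \<open>Either partial derivative of a product u(x) v(y) is again such a product, so the
  recursion of \<open>C_k\<close> never leaves the family.\<close>

lemma C_k_tensor: "smooth u \<Longrightarrow> smooth v \<Longrightarrow> C_k k (\<lambda>z. u (Re z) * v (Im z))"
proof (induction k arbitrary: u v)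
  case 0
  then show ?case
    by (auto intro!: continuous_intros continuous_on_compose2[OF smooth_continuous[of u UNIV]]
        continuous_on_compose2[OF smooth_continuous[of v UNIV]])
next
  case (Suc k)
  then show ?case
    using Suc.IH[OF smooth_deriv(2) Suc.prems(2)] Suc.IH[OF Suc.prems(1) smooth_deriv(2)]
    by (auto simp: Basis_complex_def dir_deriv_tensor_1 dir_deriv_tensor_ii differentiable_tensor)
qed

lemma tensor_test_function:
  assumes "smooth u" "smooth v"
    and u: "\<And>x. x \<notin> {a..b} \<Longrightarrow> u x = 0" and v: "\<And>y. y \<notin> {c..d} \<Longrightarrow> v y = 0"
    and sub: "cbox (Complex a c) (Complex b d) \<subseteq> unit_disk"
  shows "(\<lambda>z. u (Re z) * v (Im z)) \<in> test_functions"
proof -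
  have "{z. u (Re z) * v (Im z) \<noteq> 0} \<subseteq> cbox (Complex a c) (Complex b d)"
    using u v by (force simp: in_cbox_complex_iff)
  then have cl: "closure {z. u (Re z) * v (Im z) \<noteq> 0} \<subseteq> cbox (Complex a c) (Complex b d)"
    by (rule closure_minimal) (rule closed_cbox)
  then have "compact (closure {z. u (Re z) * v (Im z) \<noteq> 0})"
    by (meson bounded_cbox bounded_subset closed_closure compact_eq_bounded_closed)
  then show ?thesis using cl sub C_k_tensor[OF assms(1,2)] unfolding test_functions_def by auto
qed

text \<open>The positive and negative parts of \<open>h\<close> are densities of two measures that
  agree on boxes, an intersection-stable generator. The measures coincide, hence so do the densities
  almost everywhere, and a number whose positive and negative parts are equal is 0.\<close>

lemma AE_zero_if_integral_box_zero:
  fixes h :: "'a::euclidean_space \<Rightarrow> real"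
  assumes h: "integrable lborel h"
    and zero: "\<And>a b. (\<integral>x. indicator (box a b) x * h x \<partial>lborel) = 0"
  shows "AE x in lborel. h x = 0"
proof -
  note [measurable] = borel_measurable_integrable[OF h]
  let ?p = "\<lambda>x. ennreal (max 0 (h x))" and ?n = "\<lambda>x. ennreal (max 0 (- h x))"
  have e: "emeasure (density lborel (\<lambda>x. ennreal (max 0 (s * h x)))) (box a b)
      = ennreal (\<integral>x. indicator (box a b) x * max 0 (s * h x) \<partial>lborel)"
    and i: "integrable lborel (\<lambda>x. indicator (box a b) x * max 0 (s * h x))" for s :: real and a b
  proof -
    have "integrable lborel (\<lambda>x. max 0 (s * h x))" using h by auto
    then show i: "integrable lborel (\<lambda>x. indicator (box a b) x * max 0 (s * h x))"
      using integrable_mult_indicator[of "box a b" lborel "\<lambda>x. max 0 (s * h x)"] by simp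
    show "emeasure (density lborel (\<lambda>x. ennreal (max 0 (s * h x)))) (box a b)
      = ennreal (\<integral>x. indicator (box a b) x * max 0 (s * h x) \<partial>lborel)"
      by (subst emeasure_density, simp, simp, subst nn_integral_eq_integral[OF i, symmetric])
        (auto intro!: nn_integral_cong simp: indicator_def)
  qed
  have "density lborel ?p = density lborel ?n"
  proof (rule measure_eqI_generator_eq)
    let ?E = "range (\<lambda>(a, b). box a b::'a set)"
    show "Int_stable ?E"
      by (auto simp: Int_stable_def box_Int_box)
    show "?E \<subseteq> Pow UNIV" "sets (density lborel ?p) = sigma_sets UNIV ?E" "sets (density lborel ?n) = sigma_sets UNIV ?E"
      by (simp_all add: borel_eq_box)
    let ?A = "\<lambda>n::nat. box (- (real n *\<^sub>R One)) (real n *\<^sub>R One) :: 'a set"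
    show "range ?A \<subseteq> ?E" "(\<Union>i. ?A i) = UNIV"
      unfolding UN_box_eq_UNIV by auto
    show "emeasure (density lborel ?p) (?A i) \<noteq> \<infinity>" for i
      using e[of 1] by simp
    show "emeasure (density lborel ?p) X = emeasure (density lborel ?n) X" if X: "X \<in> ?E" for X
    proof -
      obtain a b where X: "X = box a b" using X by auto
      have "(\<integral>x. indicator X x * max 0 (1 * h x) \<partial>lborel) - (\<integral>x. indicator X x * max 0 ((-1) * h x) \<partial>lborel)
          = (\<integral>x. indicator X x * max 0 (1 * h x) - indicator X x * max 0 ((-1) * h x) \<partial>lborel)"
        unfolding X by (intro Bochner_Integration.integral_diff[symmetric] i)
      also have "\<dots> = (\<integral>x. indicator X x * h x \<partial>lborel)"
        by (intro Bochner_Integration.integral_cong) (auto simp: indicator_def)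
      finally show ?thesis using e[of 1 a b] e[of "-1" a b] zero[of a b] by (simp add: X)
    qed
  qed
  then have "AE x in lborel. ?p x = ?n x"
    using sigma_finite_measure.density_unique[OF sigma_finite_lborel, of ?p ?n] by simp
  then show ?thesis
  proof eventually_elim
    case (elim x)
    then have "max 0 (h x) = max 0 (- h x)" by (simp add: ennreal_inj)
    then show ?case by (auto simp: max_def split: if_splits)
  qed
qed

text \<open>Localization: an open set is a countable union of closed boxes, on each of which the
  global statement applies to \<open>h\<close> cut off to the interior; box boundaries are
  null.\<close>

lemma AE_zero_on_open:
  fixes h :: "'a::euclidean_space \<Rightarrow> real"
  assumes h: "integrable lborel h" and S: "open S"
    and zero: "\<And>a b. cbox a b \<subseteq> S \<Longrightarrow> (\<integral>x. indicator (box a b) x * h x \<partial>lborel) = 0"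
  shows "AE x in lborel. x \<in> S \<longrightarrow> h x = 0"
proof -
  obtain \<D> where \<D>: "countable \<D>" "\<D> \<subseteq> Pow S" "\<And>X. X \<in> \<D> \<Longrightarrow> \<exists>a b. X = cbox a b" "\<Union>\<D> = S"
    using open_countable_Union_open_cbox[OF S] by blast
  have "AE x in lborel. x \<in> X \<longrightarrow> h x = 0" if XD: "X \<in> \<D>" for X
  proof -
    obtain a b where X: "X = cbox a b" using \<D>(3)[OF XD] by blast
    then have sub: "cbox a b \<subseteq> S" using \<D>(2) XD by blast
    have "AE x in lborel. indicator (box a b) x * h x = 0"
    proof (rule AE_zero_if_integral_box_zero)
      show "integrable lborel (\<lambda>x. indicator (box a b) x * h x)"
        using integrable_mult_indicator[OF _ h, of "box a b"] by simp
      fix c d :: 'a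
      obtain c' d' where cd: "box c d \<inter> box a b = box c' d'" by (auto simp: box_Int_box)
      have "(\<integral>x. indicator (box c d) x * (indicator (box a b) x * h x) \<partial>lborel) = (\<integral>x. indicator (box c' d') x * h x \<partial>lborel)"
        unfolding cd[symmetric] by (intro Bochner_Integration.integral_cong) (auto simp: indicator_def)
      also have "\<dots> = 0"
      \<comment> \<open>Only a nonempty open box has the corresponding \<open>cbox\<close> as its
        closure, which is what places \<open>cbox c' d'\<close> inside \<open>cbox a b\<close>; for
        an empty one the integral is 0 outright.\<close>
      proof (cases "box c' d' = {}")
        case False
        then have "cbox c' d' \<subseteq> cbox a b"
          using closure_mono[of "box c' d'" "cbox a b"] box_subset_cbox[of a b] cd by (auto simp: closure_box)
        then show ?thesis using zero sub by blast
      qed simp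
      finally show "(\<integral>x. indicator (box c d) x * (indicator (box a b) x * h x) \<partial>lborel) = 0" .
    qed
    moreover have "AE x in lborel. x \<notin> cbox a b - box a b"
    proof (rule AE_not_in)
      have "emeasure lborel (cbox a b - box a b) = 0"
        using box_subset_cbox[of a b]
        by (subst emeasure_Diff) (auto simp: emeasure_lborel_box_eq emeasure_lborel_cbox_eq)
      then show "cbox a b - box a b \<in> null_sets lborel" by auto
    qed
    ultimately show ?thesis by eventually_elim (auto simp: X)
  qed
  then have "AE x in lborel. \<forall>X\<in>\<D>. x \<in> X \<longrightarrow> h x = 0"
    using \<D>(1) by (subst AE_ball_countable) auto
  then show ?thesis by eventually_elim (use \<D>(4) in auto)
qed

text \<open>Products of bumps converge boundedly to indicators of boxes, so \<open>h\<close> has integral zero over every small box.\<close>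

lemma AE_zero_if_tensor_tests_zero:
  fixes h :: "complex \<Rightarrow> complex"
  assumes h: "integrable lborel h" and S: "open S"
    and zero: "\<And>a b c d u v. \<lbrakk>cbox (Complex a c) (Complex b d) \<subseteq> S; smooth u; smooth v;
        \<And>x. x \<notin> {a..b} \<Longrightarrow> u x = 0; \<And>y. y \<notin> {c..d} \<Longrightarrow> v y = 0\<rbrakk>
      \<Longrightarrow> (\<integral>z. h z * of_real (u (Re z) * v (Im z)) \<partial>lborel) = 0"
  shows "AE z in lborel. z \<in> S \<longrightarrow> h z = 0"
proof -
  note [measurable] = borel_measurable_integrable[OF h]
  have box0: "(\<integral>z. indicator (box a b) z *\<^sub>R h z \<partial>lborel) = 0" if sub: "cbox a b \<subseteq> S" for a b
  proof -
    let ?u = "\<lambda>n. bump n (Re a) (Re b)" and ?v = "\<lambda>n. bump n (Im a) (Im b)"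
    have [measurable]: "bump n c d \<in> borel_measurable borel" for n c d
      using smooth_continuous[OF smooth_bump] by (intro borel_measurable_continuous_onI)
    have "(\<lambda>n. \<integral>z. h z * of_real (?u n (Re z) * ?v n (Im z)) \<partial>lborel) \<longlonglongrightarrow> (\<integral>z. indicator (box a b) z *\<^sub>R h z \<partial>lborel)"
    proof (rule integral_dominated_convergence[where w = "\<lambda>z. norm (h z)"])
      show "AE z in lborel. (\<lambda>n. h z * of_real (?u n (Re z) * ?v n (Im z))) \<longlonglongrightarrow> indicator (box a b) z *\<^sub>R h z"
      proof (rule AE_I2)
        fix z
        have "indicator (box a b) z = (indicator {Re a<..<Re b} (Re z) * indicator {Im a<..<Im b} (Im z) :: real)"
          by (auto simp: indicator_def in_box_complex_iff)
        moreover have "(\<lambda>n. h z * of_real (?u n (Re z) * ?v n (Im z)))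
            \<longlonglongrightarrow> h z * of_real (indicator {Re a<..<Re b} (Re z) * indicator {Im a<..<Im b} (Im z))"
          by (intro tendsto_intros bump_tendsto)
        ultimately show "(\<lambda>n. h z * of_real (?u n (Re z) * ?v n (Im z))) \<longlonglongrightarrow> indicator (box a b) z *\<^sub>R h z"
          by (simp add: scaleR_conv_of_real mult.commute)
      qed
      show "AE z in lborel. norm (h z * of_real (?u n (Re z) * ?v n (Im z))) \<le> norm (h z)" for n
      proof (rule AE_I2)
        fix z
        have "\<bar>?u n (Re z) * ?v n (Im z)\<bar> \<le> 1"
          using mult_mono[OF bump_bounds(2)[of n "Re a" "Re b" "Re z"] bump_bounds(2)[of n "Im a" "Im b" "Im z"]]
            bump_bounds(1)[of n "Re a" "Re b" "Re z"] bump_bounds(1)[of n "Im a" "Im b" "Im z"] by simp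
        then show "norm (h z * of_real (?u n (Re z) * ?v n (Im z))) \<le> norm (h z)"
          by (simp only: norm_mult norm_of_real) (rule mult_left_le, auto)
      qed
    qed (use h in auto)
    moreover have "(\<integral>z. h z * of_real (?u n (Re z) * ?v n (Im z)) \<partial>lborel) = 0" for n
      by (rule zero[of "Re a" "Im a" "Re b" "Im b"]) (use sub in \<open>auto simp: smooth_bump bump_eq_0\<close>)
    ultimately show ?thesis by (simp add: LIMSEQ_const_iff)
  qed
  have ib: "integrable lborel (\<lambda>z. indicator (box a b) z *\<^sub>R h z)" for a b
    by (intro integrable_mult_indicator h) auto
  have "AE z in lborel. z \<in> S \<longrightarrow> Re (h z) = 0"
  proof (rule AE_zero_on_open)
    show "(\<integral>x. indicator (box a b) x * Re (h x) \<partial>lborel) = 0" if "cbox a b \<subseteq> S" for a b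
      using box0[OF that] integral_Re[OF ib, of a b] by simp
  qed (use h S in auto)
  moreover have "AE z in lborel. z \<in> S \<longrightarrow> Im (h z) = 0"
  proof (rule AE_zero_on_open)
    show "(\<integral>x. indicator (box a b) x * Im (h x) \<partial>lborel) = 0" if "cbox a b \<subseteq> S" for a b
      using box0[OF that] integral_Im[OF ib, of a b] by simp
  qed (use h S in auto)
  ultimately show ?thesis by eventually_elim (auto simp: complex_eq_iff)
qed

section \<open>Dilations of Sobolev functions\<close>

lemma integrable_mult_continuous:
  fixes W :: "'a::euclidean_space \<Rightarrow> complex" and q :: "'a \<Rightarrow> real"
  assumes W: "integrable lborel W" and W0: "\<And>z. z \<notin> S \<Longrightarrow> W z = 0"
    and S: "compact S" and q: "continuous_on S q" and [measurable]: "q \<in> borel_measurable borel"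
  shows "integrable lborel (\<lambda>z. W z * of_real (q z))"
proof -
  have "bounded (q ` S)" by (intro compact_imp_bounded compact_continuous_image q S)
  then obtain B where B: "\<And>z. z \<in> S \<Longrightarrow> \<bar>q z\<bar> \<le> B" by (auto simp: bounded_iff)
  have [measurable]: "W \<in> borel_measurable borel" using W by auto
  show ?thesis
  proof (rule Bochner_Integration.integrable_bound)
    show "integrable lborel (\<lambda>z. B *\<^sub>R W z)" using W by auto
    have "norm (W z * of_real (q z)) \<le> norm (B *\<^sub>R W z)" for z
    proof (cases "z \<in> S")
      case True
      then show ?thesis using B[OF True] by (simp add: norm_mult mult.commute mult_right_mono)
    qed (simp add: W0)
    then show "AE z in lborel. norm (W z * of_real (q z)) \<le> norm (B *\<^sub>R W z)" by simp
  qed simp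
qed

text \<open>Undoing the dilation costs the Jacobian factor t^(-2), which together with 1/t is at
  most r^(-3) for t between \<open>r\<close> and 1. Staying away from t = 0 is what makes the double
  integral finite.\<close>

lemma integrable_dilations:
  fixes g :: "complex \<Rightarrow> complex"
  assumes g: "integrable lborel g" and r: "0 < r" "r < 1"
  shows "integrable (lborel \<Otimes>\<^sub>M lborel) (\<lambda>(t::real, z). indicator {r..1} t *\<^sub>R ((1 / t) *\<^sub>R g (t *\<^sub>R z)))"
proof (rule integrableI_bounded)
  have [measurable]: "g \<in> borel_measurable borel" using g by auto
  show "(\<lambda>(t::real, z). indicator {r..1} t *\<^sub>R ((1 / t) *\<^sub>R g (t *\<^sub>R z))) \<in> borel_measurable (lborel \<Otimes>\<^sub>M lborel)"
    by measurable
  let ?I = "\<integral>\<^sup>+z. norm (g z) \<partial>lborel"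
  have "?I < \<infinity>" using g by (simp add: integrable_iff_bounded)
  have "(\<integral>\<^sup>+x. norm (case x of (t::real, z) \<Rightarrow> indicator {r..1} t *\<^sub>R ((1 / t) *\<^sub>R g (t *\<^sub>R z))) \<partial>(lborel \<Otimes>\<^sub>M lborel))
      = (\<integral>\<^sup>+t. \<integral>\<^sup>+z. norm (indicator {r..1} t *\<^sub>R ((1 / t) *\<^sub>R g (t *\<^sub>R z))) \<partial>lborel \<partial>lborel)"
    by (subst lborel.nn_integral_fst[symmetric]) auto
  also have "\<dots> \<le> (\<integral>\<^sup>+t. indicator {r..1} t * (ennreal (1 / r ^ 3) * ?I) \<partial>lborel)"
  proof (rule nn_integral_mono)
    fix t :: real
    show "(\<integral>\<^sup>+z. norm (indicator {r..1} t *\<^sub>R ((1 / t) *\<^sub>R g (t *\<^sub>R z))) \<partial>lborel)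
        \<le> indicator {r..1} t * (ennreal (1 / r ^ 3) * ?I)"
    proof (cases "t \<in> {r..1}")
      case True
      then have t: "0 < t" "r \<le> t" using r by auto
      let ?J = "\<integral>\<^sup>+z. norm (g (t *\<^sub>R z)) \<partial>lborel"
      have "(\<integral>\<^sup>+z. norm (indicator {r..1} t *\<^sub>R ((1 / t) *\<^sub>R g (t *\<^sub>R z))) \<partial>lborel) = ennreal (1 / t) * ?J"
        using True t by (subst nn_integral_cmult[symmetric]) (auto simp: ennreal_mult'[symmetric] divide_inverse)
      also have "ennreal (1 / t) * ?J = ennreal (1 / t ^ 3) * (ennreal (t ^ 2) * ?J)"
        using t by (simp add: mult.assoc[symmetric] ennreal_mult'[symmetric] power2_eq_square power3_eq_cube)
      also have "ennreal (t ^ 2) * ?J = ?I"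
        using nn_integral_lborel_scaleR[of "\<lambda>z. norm (g z)" t] t by simp
      also have "ennreal (1 / t ^ 3) * ?I \<le> ennreal (1 / r ^ 3) * ?I"
        using t r by (intro mult_right_mono ennreal_leI divide_left_mono power_mono) auto
      finally show ?thesis using True by simp
    qed simp
  qed
  also have "\<dots> = emeasure lborel {r..1} * (ennreal (1 / r ^ 3) * ?I)"
    by (simp add: nn_integral_multc)
  also have "\<dots> < \<infinity>"
    using \<open>?I < \<infinity>\<close> r by (simp add: ennreal_mult_less_top)
  finally show "(\<integral>\<^sup>+x. norm (case x of (t::real, z) \<Rightarrow> indicator {r..1} t *\<^sub>R ((1 / t) *\<^sub>R g (t *\<^sub>R z))) \<partial>(lborel \<Otimes>\<^sub>M lborel)) < \<infinity>" .
qed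

text \<open>This is the Fubini hypothesis after the t-dependence has moved to the test function. The
  kernel is bounded only where \<open>W\<close> is nonzero, so compactness of
  \<open>{r..1} \<times> cball 0 1\<close> can supply the bound.\<close>

lemma integrable_pair_bounded_kernel:
  fixes W :: "complex \<Rightarrow> complex" and K :: "real \<Rightarrow> complex \<Rightarrow> real"
  assumes W: "integrable lborel W" and [measurable]: "case_prod K \<in> borel_measurable (lborel \<Otimes>\<^sub>M lborel)"
    and B: "\<And>t z. t \<in> {r..s} \<Longrightarrow> W z \<noteq> 0 \<Longrightarrow> \<bar>K t z\<bar> \<le> B"
  shows "integrable (lborel \<Otimes>\<^sub>M lborel) (\<lambda>(t, z). indicator {r..s} t *\<^sub>R (W z * of_real (K t z)))"
proof (rule integrableI_bounded)
  have [measurable]: "W \<in> borel_measurable borel" using W by auto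
  have [measurable]: "(\<lambda>x. K (fst x) (snd x)) \<in> borel_measurable (lborel \<Otimes>\<^sub>M lborel)"
    using assms(2) by (simp add: case_prod_beta')
  show "(\<lambda>(t, z). indicator {r..s} t *\<^sub>R (W z * of_real (K t z))) \<in> borel_measurable (lborel \<Otimes>\<^sub>M lborel)"
    unfolding case_prod_beta' by measurable
  let ?I = "\<integral>\<^sup>+z. norm (W z) \<partial>lborel"
  have "?I < \<infinity>" using W by (simp add: integrable_iff_bounded)
  have "(\<integral>\<^sup>+x. norm (case x of (t, z) \<Rightarrow> indicator {r..s} t *\<^sub>R (W z * of_real (K t z))) \<partial>(lborel \<Otimes>\<^sub>M lborel))
      \<le> (\<integral>\<^sup>+x. indicator {r..s} (fst x) * (ennreal \<bar>B\<bar> * ennreal (norm (W (snd x)))) \<partial>((lborel::real measure) \<Otimes>\<^sub>M lborel))"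
  proof (rule nn_integral_mono)
    fix x :: "real \<times> complex"
    obtain t z where x: "x = (t, z)" by (cases x)
    show "ennreal (norm (case x of (t, z) \<Rightarrow> indicator {r..s} t *\<^sub>R (W z * of_real (K t z))))
        \<le> indicator {r..s} (fst x) * (ennreal \<bar>B\<bar> * ennreal (norm (W (snd x))))"
    proof (cases "t \<in> {r..s} \<and> W z \<noteq> 0")
      case True
      have "norm (W z) * \<bar>K t z\<bar> \<le> norm (W z) * \<bar>B\<bar>"
        using B[of t z] True by (intro mult_left_mono) auto
      then show ?thesis
        using True by (simp add: x norm_mult ennreal_mult'[symmetric] mult.commute ennreal_leI)
    qed (auto simp: x)
  qed
  also have "\<dots> = (\<integral>\<^sup>+t. indicator {r..s} t * (ennreal \<bar>B\<bar> * ?I) \<partial>lborel)"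
    by (subst lborel.nn_integral_fst[symmetric]) (auto simp: nn_integral_cmult intro!: nn_integral_cong)
  also have "\<dots> = emeasure lborel {r..s} * (ennreal \<bar>B\<bar> * ?I)"
    by (simp add: nn_integral_multc)
  also have "\<dots> < \<infinity>"
    using \<open>?I < \<infinity>\<close> by (auto simp: ennreal_mult_less_top emeasure_lborel_Icc_eq)
  finally show "(\<integral>\<^sup>+x. norm (case x of (t, z) \<Rightarrow> indicator {r..s} t *\<^sub>R (W z * of_real (K t z))) \<partial>(lborel \<Otimes>\<^sub>M lborel)) < \<infinity>" .
qed

text \<open>Let \<phi>(z) = u(x) v(y). The factor of \<open>W\<close> on the left is the
  t-derivative of \<phi>(w/t)/t^2. It equals -t^(-3) times the divergence in w of the vector field w
  \<phi>(w/t), so testing the two weak derivatives with the components of this field and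
  substituting w = tz gives the right-hand side.\<close>

lemma weak_radial_derivative:
  fixes W X Y :: "complex \<Rightarrow> complex" and u v :: "real \<Rightarrow> real" and t :: real
  assumes int: "integrable lborel W" "integrable lborel X" "integrable lborel Y"
    and W0: "\<And>z. z \<notin> unit_disk \<Longrightarrow> W z = 0"
    and X0: "\<And>z. z \<notin> unit_disk \<Longrightarrow> X z = 0" and Y0: "\<And>z. z \<notin> unit_disk \<Longrightarrow> Y z = 0"
    and wX: "\<And>\<phi>. \<phi> \<in> test_functions \<Longrightarrow> (\<integral>z. W z * of_real (dir_deriv \<phi> 1 z) \<partial>lborel) = - (\<integral>z. X z * of_real (\<phi> z) \<partial>lborel)"
    and wY: "\<And>\<phi>. \<phi> \<in> test_functions \<Longrightarrow> (\<integral>z. W z * of_real (dir_deriv \<phi> \<i> z) \<partial>lborel) = - (\<integral>z. Y z * of_real (\<phi> z) \<partial>lborel)"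
    and uv: "smooth u" "smooth v"
    and u0: "\<And>x. x \<notin> {a..b} \<Longrightarrow> u x = 0" and v0: "\<And>y. y \<notin> {c..d} \<Longrightarrow> v y = 0"
    and sub: "cbox (Complex a c) (Complex b d) \<subseteq> unit_disk" and t: "0 < t" "t \<le> 1"
  shows "(\<integral>w. W w * of_real (- (2 * u (Re w / t) * v (Im w / t) + Re w / t * deriv u (Re w / t) * v (Im w / t)
             + Im w / t * u (Re w / t) * deriv v (Im w / t)) / t ^ 3) \<partial>lborel)
    = (\<integral>z. of_real (u (Re z) * v (Im z)) * ((1 / t) *\<^sub>R (Re (t *\<^sub>R z) *\<^sub>R X (t *\<^sub>R z) + Im (t *\<^sub>R z) *\<^sub>R Y (t *\<^sub>R z))) \<partial>lborel)"
    (is "?L = ?R")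
proof -
  \<comment> \<open>The disk is star-shaped about 0, so the support of \<phi>(w/t) stays inside it
    for t at most 1.\<close>
  have sub': "cbox (Complex (t * a) (t * c)) (Complex (t * b) (t * d)) \<subseteq> unit_disk"
  proof
    fix w assume "w \<in> cbox (Complex (t * a) (t * c)) (Complex (t * b) (t * d))"
    then have "w /\<^sub>R t \<in> cbox (Complex a c) (Complex b d)"
      using t by (auto simp: in_cbox_complex_iff field_simps)
    then have "norm (w /\<^sub>R t) < 1" using sub by auto
    then show "w \<in> unit_disk" using t by (simp add: field_simps)
  qed
  define U V where "U x = u (x / t)" and "V x = v (x / t)" for x
  define U' V' where "U' x = deriv u (x / t) / t" and "V' x = deriv v (x / t) / t" for x
  have sm: "smooth U" "smooth V"
    using smooth_affine[OF uv(1), of "1 / t" 0] smooth_affine[OF uv(2), of "1 / t" 0] by (auto simp: U_def[abs_def] V_def[abs_def])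
  have sm1: "smooth (\<lambda>x. x * U x)" "smooth (\<lambda>x. x * V x)"
    using sm by (auto intro!: smooth_mult smooth_id)
  have scale: "x / t \<notin> {a..b}" if "x \<notin> {t * a..t * b}" for x a b :: real
    using that t by (auto simp: field_simps)
  have supp: "U x = 0" if "x \<notin> {t * a..t * b}" for x
    using u0[OF scale[OF that]] by (simp add: U_def)
  have supp': "V x = 0" if "x \<notin> {t * c..t * d}" for x
    using v0[OF scale[OF that]] by (simp add: V_def)
  have dU: "(U has_real_derivative U' x) (at x)" for x
    using DERIV_chain2[OF smooth_deriv(1)[OF uv(1)] DERIV_cdivide[OF DERIV_ident], of t x]
    by (simp add: U_def[abs_def] U'_def)
  have dV: "(V has_real_derivative V' x) (at x)" for x
    using DERIV_chain2[OF smooth_deriv(1)[OF uv(2)] DERIV_cdivide[OF DERIV_ident], of t x]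
    by (simp add: V_def[abs_def] V'_def)
  have d1: "deriv (\<lambda>x. x * U x) x = U x + x * U' x" for x
    by (rule DERIV_imp_deriv) (auto intro!: derivative_eq_intros dU)
  have d2: "deriv (\<lambda>x. x * V x) x = V x + x * V' x" for x
    by (rule DERIV_imp_deriv) (auto intro!: derivative_eq_intros dV)
  have cont: "continuous_on A (\<lambda>z. q (Re z))" "continuous_on A (\<lambda>z. q (Im z))" if "smooth q" for q A
    using smooth_continuous[OF that, of UNIV] by (auto intro!: continuous_on_compose2[of UNIV q] continuous_intros)
  have intq: "integrable lborel (\<lambda>z. Q z * of_real (q1 (Re z) * q2 (Im z)))"
    if "smooth q1" "smooth q2" "integrable lborel Q" "\<And>z. z \<notin> unit_disk \<Longrightarrow> Q z = 0" for Q :: "complex \<Rightarrow> complex" and q1 q2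
    using that(3)
  proof (rule integrable_mult_continuous[where S = "cball 0 1"])
    have c: "continuous_on A (\<lambda>z. q1 (Re z) * q2 (Im z))" for A
      by (intro continuous_on_mult cont that)
    then show "continuous_on (cball 0 1) (\<lambda>z. q1 (Re z) * q2 (Im z))" .
    show "(\<lambda>z. q1 (Re z) * q2 (Im z)) \<in> borel_measurable borel"
      by (rule borel_measurable_continuous_onI) (rule c)
  qed (use that(4) in auto)
  \<comment> \<open>These are the components of the field w \<phi>(w/t). A coordinate factor can be
    absorbed into one of the one-variable functions, so both remain products.\<close>
  let ?\<phi> = "\<lambda>z. (Re z * U (Re z)) * V (Im z)" and ?\<psi> = "\<lambda>z. U (Re z) * (Im z * V (Im z))"
  have neg: "(- 1 / k) *\<^sub>R (- A + - B) = (1 / k) *\<^sub>R (A + B)" for A B :: complex and k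
  proof -
    have "- A + - B = - (A + B)" by simp
    then show ?thesis by (simp only: minus_divide_left[symmetric] scaleR_minus_left scaleR_minus_right minus_minus)
  qed
  have t1: "?\<phi> \<in> test_functions"
    by (rule tensor_test_function[OF sm1(1) sm(2) _ _ sub']) (use supp supp' in auto)
  have t2: "?\<psi> \<in> test_functions"
    by (rule tensor_test_function[OF sm(1) sm1(2) _ _ sub']) (use supp supp' in auto)
  have e1: "dir_deriv ?\<phi> 1 z = deriv (\<lambda>x. x * U x) (Re z) * V (Im z)" for z
    using fun_cong[OF dir_deriv_tensor_1[OF sm1(1) sm(2)], of z] .
  have e2: "dir_deriv ?\<psi> \<i> z = U (Re z) * deriv (\<lambda>x. x * V x) (Im z)" for z
    using fun_cong[OF dir_deriv_tensor_ii[OF sm(1) sm1(2)], of z] .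
  have "?L = (\<integral>w. (- 1 / t ^ 3) *\<^sub>R (W w * of_real (deriv (\<lambda>x. x * U x) (Re w) * V (Im w))
      + W w * of_real (U (Re w) * deriv (\<lambda>x. x * V x) (Im w))) \<partial>lborel)"
  proof (rule Bochner_Integration.integral_cong[OF refl])
    fix w
    have "- (2 * u (Re w / t) * v (Im w / t) + Re w / t * deriv u (Re w / t) * v (Im w / t)
             + Im w / t * u (Re w / t) * deriv v (Im w / t)) / t ^ 3
        = (- 1 / t ^ 3) * (deriv (\<lambda>x. x * U x) (Re w) * V (Im w) + U (Re w) * deriv (\<lambda>x. x * V x) (Im w))"
      unfolding d1 d2 unfolding U_def V_def U'_def V'_def using t by (simp add: field_simps)
    then show "W w * of_real (- (2 * u (Re w / t) * v (Im w / t) + Re w / t * deriv u (Re w / t) * v (Im w / t)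
             + Im w / t * u (Re w / t) * deriv v (Im w / t)) / t ^ 3)
        = (- 1 / t ^ 3) *\<^sub>R (W w * of_real (deriv (\<lambda>x. x * U x) (Re w) * V (Im w))
      + W w * of_real (U (Re w) * deriv (\<lambda>x. x * V x) (Im w)))"
      by (simp only: scaleR_conv_of_real of_real_mult of_real_add distrib_left mult_ac)
  qed
  also have "\<dots> = (- 1 / t ^ 3) *\<^sub>R ((\<integral>w. W w * of_real (deriv (\<lambda>x. x * U x) (Re w) * V (Im w)) \<partial>lborel)
      + (\<integral>w. W w * of_real (U (Re w) * deriv (\<lambda>x. x * V x) (Im w)) \<partial>lborel))"
    by (subst Bochner_Integration.integral_scaleR_right, subst Bochner_Integration.integral_add)
      (intro intq sm sm1 smooth_deriv(2) int W0 refl | simp)+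
  also have "(\<integral>w. W w * of_real (deriv (\<lambda>x. x * U x) (Re w) * V (Im w)) \<partial>lborel) = - (\<integral>z. X z * of_real (?\<phi> z) \<partial>lborel)"
    using wX[OF t1] unfolding e1 .
  also have "(\<integral>w. W w * of_real (U (Re w) * deriv (\<lambda>x. x * V x) (Im w)) \<partial>lborel) = - (\<integral>z. Y z * of_real (?\<psi> z) \<partial>lborel)"
    using wY[OF t2] unfolding e2 .
  also have "(- 1 / t ^ 3) *\<^sub>R (- (\<integral>z. X z * of_real (?\<phi> z) \<partial>lborel) + - (\<integral>z. Y z * of_real (?\<psi> z) \<partial>lborel))
      = (1 / t ^ 3) *\<^sub>R ((\<integral>z. X z * of_real (?\<phi> z) \<partial>lborel) + (\<integral>z. Y z * of_real (?\<psi> z) \<partial>lborel))"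
    by (rule neg)
  also have "(\<integral>z. X z * of_real (?\<phi> z) \<partial>lborel) + (\<integral>z. Y z * of_real (?\<psi> z) \<partial>lborel)
      = (\<integral>z. X z * of_real (?\<phi> z) + Y z * of_real (?\<psi> z) \<partial>lborel)"
    by (intro Bochner_Integration.integral_add[symmetric] intq sm sm1 int X0 Y0)
  also have "\<dots> = (\<integral>w. of_real (U (Re w) * V (Im w)) * (Re w *\<^sub>R X w + Im w *\<^sub>R Y w) \<partial>lborel)"
    by (intro Bochner_Integration.integral_cong) (auto simp: scaleR_conv_of_real algebra_simps)
  also have "\<dots> = t ^ DIM(complex) *\<^sub>R (\<integral>z. of_real (U (Re (t *\<^sub>R z)) * V (Im (t *\<^sub>R z))) *
      (Re (t *\<^sub>R z) *\<^sub>R X (t *\<^sub>R z) + Im (t *\<^sub>R z) *\<^sub>R Y (t *\<^sub>R z)) \<partial>lborel)"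
  proof (rule integral_lborel_scaleR[OF _ t(1)])
    have [measurable]: "X \<in> borel_measurable borel" "Y \<in> borel_measurable borel" "U \<in> borel_measurable borel" "V \<in> borel_measurable borel"
      using int sm by (auto intro: borel_measurable_continuous_onI smooth_continuous)
    show "(\<lambda>w. of_real (U (Re w) * V (Im w)) * (Re w *\<^sub>R X w + Im w *\<^sub>R Y w)) \<in> borel_measurable borel"
      by measurable
  qed
  \<comment> \<open>The real dimension of the plane is 2, so the Jacobian t^2 reduces t^(-3) to
    1/t.\<close>
  also have "(1 / t ^ 3) *\<^sub>R (t ^ DIM(complex) *\<^sub>R (\<integral>z. of_real (U (Re (t *\<^sub>R z)) * V (Im (t *\<^sub>R z))) *
      (Re (t *\<^sub>R z) *\<^sub>R X (t *\<^sub>R z) + Im (t *\<^sub>R z) *\<^sub>R Y (t *\<^sub>R z)) \<partial>lborel)) =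
      (1 / t) *\<^sub>R (\<integral>z. of_real (U (Re (t *\<^sub>R z)) * V (Im (t *\<^sub>R z))) *
      (Re (t *\<^sub>R z) *\<^sub>R X (t *\<^sub>R z) + Im (t *\<^sub>R z) *\<^sub>R Y (t *\<^sub>R z)) \<partial>lborel)"
    using t by (simp add: power2_eq_square power3_eq_cube del: scaleR_complex.sel)
  also have "\<dots> = ?R"
    using t by (simp only: integral_scaleR_right[symmetric])
      (auto simp: U_def V_def intro!: Bochner_Integration.integral_cong)
  finally show ?thesis .
qed

text \<open>Formally the t-derivative of W(tz) is g(tz)/t, where g(w) is the scalar product of w
  with the gradient of W, and the claim is the fundamental theorem of calculus on [r, 1].
  Rigorously, both sides are paired with \<phi>. On the left the dilation goes over to \<phi>, where
  the fundamental theorem is classical; Fubini and the weak radial derivative at each fixed t then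
  produce the right-hand side.\<close>

lemma dilation_difference_eq:
  fixes W X Y :: "complex \<Rightarrow> complex"
  assumes int: "integrable lborel W" "integrable lborel X" "integrable lborel Y"
    and W0: "\<And>z. z \<notin> unit_disk \<Longrightarrow> W z = 0"
    and X0: "\<And>z. z \<notin> unit_disk \<Longrightarrow> X z = 0" and Y0: "\<And>z. z \<notin> unit_disk \<Longrightarrow> Y z = 0"
    and wX: "\<And>\<phi>. \<phi> \<in> test_functions \<Longrightarrow> (\<integral>z. W z * of_real (dir_deriv \<phi> 1 z) \<partial>lborel) = - (\<integral>z. X z * of_real (\<phi> z) \<partial>lborel)"
    and wY: "\<And>\<phi>. \<phi> \<in> test_functions \<Longrightarrow> (\<integral>z. W z * of_real (dir_deriv \<phi> \<i> z) \<partial>lborel) = - (\<integral>z. Y z * of_real (\<phi> z) \<partial>lborel)"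
    and r: "0 < r" "r < 1"
  defines "g \<equiv> \<lambda>w. Re w *\<^sub>R X w + Im w *\<^sub>R Y w"
  shows "AE z in lborel. z \<in> unit_disk \<longrightarrow>
    W z - W (r *\<^sub>R z) = (\<integral>t. indicator {r..1} t *\<^sub>R ((1 / t) *\<^sub>R g (t *\<^sub>R z)) \<partial>lborel)"
proof -
  define G where "G z = (\<integral>t. indicator {r..1} t *\<^sub>R ((1 / t) *\<^sub>R g (t *\<^sub>R z)) \<partial>lborel)" for z
  have [measurable]: "W \<in> borel_measurable borel" "X \<in> borel_measurable borel" "Y \<in> borel_measurable borel"
    using int by auto
  have gX: "integrable lborel (\<lambda>w. X w * of_real (Re w))"
    by (rule integrable_mult_continuous[OF int(2), where S = "cball 0 1"])
      (use X0 in \<open>auto intro!: continuous_intros\<close>)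
  have gY: "integrable lborel (\<lambda>w. Y w * of_real (Im w))"
    by (rule integrable_mult_continuous[OF int(3), where S = "cball 0 1"])
      (use Y0 in \<open>auto intro!: continuous_intros\<close>)
  have g: "integrable lborel g"
    using Bochner_Integration.integrable_add[OF gX gY] by (simp add: g_def scaleR_conv_of_real mult.commute)
  then have [measurable]: "g \<in> borel_measurable borel" by auto
  note gd = integrable_dilations[OF g r]
  have G: "integrable lborel G"
    unfolding G_def using lborel_pair.integrable_snd[OF gd] by simp
  have Wr: "integrable lborel (\<lambda>z. W (r *\<^sub>R z))"
    by (rule integrable_lborel_scaleR[OF int(1) r(1)])
  have "AE z in lborel. z \<in> unit_disk \<longrightarrow> W z - W (r *\<^sub>R z) - G z = 0"
  proof (rule AE_zero_if_tensor_tests_zero)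
    show "integrable lborel (\<lambda>z. W z - W (r *\<^sub>R z) - G z)"
      using int(1) Wr G by auto
    show "open unit_disk" by simp
    fix a b c d :: real and u v :: "real \<Rightarrow> real"
    assume sub: "cbox (Complex a c) (Complex b d) \<subseteq> unit_disk" and uv: "smooth u" "smooth v"
      and u0: "\<And>x. x \<notin> {a..b} \<Longrightarrow> u x = 0" and v0: "\<And>y. y \<notin> {c..d} \<Longrightarrow> v y = 0"
    define \<phi> where "\<phi> z = u (Re z) * v (Im z)" for z
    \<comment> \<open>The t-derivative of \<phi>(w/t)/t^2, written out for the product
      \<phi>.\<close>
    define K where "K t w = - (2 * u (Re w / t) * v (Im w / t) + Re w / t * deriv u (Re w / t) * v (Im w / t)
             + Im w / t * u (Re w / t) * deriv v (Im w / t)) / t ^ 3" for t w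
    have sm: "continuous_on UNIV u" "continuous_on UNIV v" "continuous_on UNIV (deriv u)" "continuous_on UNIV (deriv v)"
      by (intro smooth_continuous uv smooth_deriv(2))+
    have [measurable]: "u \<in> borel_measurable borel" "v \<in> borel_measurable borel"
      "deriv u \<in> borel_measurable borel" "deriv v \<in> borel_measurable borel"
      by (intro borel_measurable_continuous_onI sm)+
    have Km: "case_prod K \<in> borel_measurable (lborel \<Otimes>\<^sub>M lborel)"
      unfolding K_def case_prod_beta' by measurable
    have Kc: "continuous_on ({r..1} \<times> cball 0 1) (case_prod K)"
    proof -
      have *: "continuous_on ({r..1} \<times> cball 0 1) (\<lambda>x::real \<times> complex. q (Re (snd x) / fst x))"
        "continuous_on ({r..1} \<times> cball 0 1) (\<lambda>x::real \<times> complex. q (Im (snd x) / fst x))"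
        if "continuous_on UNIV q" for q :: "real \<Rightarrow> real"
        using r by (auto intro!: continuous_on_compose2[OF that] continuous_intros)
      note ** = *[OF sm(1)] *[OF sm(2)] *[OF sm(3)] *[OF sm(4)] *[OF continuous_on_id]
      show ?thesis
        unfolding K_def case_prod_beta'
        by (intro continuous_on_divide continuous_on_minus continuous_on_add continuous_on_mult
            continuous_on_const continuous_on_power continuous_on_fst continuous_on_id **) (use r in auto)
    qed
    have "bounded (case_prod K ` ({r..1} \<times> cball 0 1))"
      by (intro compact_imp_bounded compact_continuous_image Kc compact_Times) auto
    then obtain B where B: "\<And>x. x \<in> {r..1} \<times> cball 0 1 \<Longrightarrow> norm (case_prod K x) \<le> B"
      unfolding bounded_iff by blast
    have WK: "integrable (lborel \<Otimes>\<^sub>M lborel) (\<lambda>(t, w). indicator {r..1} t *\<^sub>R (W w * of_real (K t w)))"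
    proof (rule integrable_pair_bounded_kernel[OF int(1) Km])
      fix t :: real and z assume "t \<in> {r..1}" "W z \<noteq> 0"
      moreover have "z \<in> unit_disk" using W0 \<open>W z \<noteq> 0\<close> by blast
      ultimately show "\<bar>K t z\<bar> \<le> B" using B[of "(t, z)"] by auto
    qed
    \<comment> \<open>The endpoint t = r yields exactly the term that arises from substituting w =
      rz in the integral of \<phi>(z) W(rz).\<close>
    have FTC: "(\<integral>t. indicator {r..1} t *\<^sub>R K t w \<partial>lborel) = \<phi> w - \<phi> (w /\<^sub>R r) / r\<^sup>2" for w
    proof -
      define F where "F t = u (Re w / t) * v (Im w / t) / t\<^sup>2" for t
      have "(\<integral>t. indicator {r..1} t *\<^sub>R K t w \<partial>lborel) = F 1 - F r"
      proof (rule integral_FTC_Icc)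
        fix t assume t: "r \<le> t" "t \<le> 1"
        then have t0: "t \<noteq> 0" using r by auto
        have dq: "((\<lambda>t. q (x / t)) has_real_derivative deriv q (x / t) * (- x / t\<^sup>2)) (at t within {r..1})"
          if "smooth q" for q x
        proof (rule DERIV_chain2[OF smooth_deriv(1)[OF that]])
          show "((\<lambda>t. x / t) has_real_derivative - x / t\<^sup>2) (at t within {r..1})"
            using t0 by (auto intro!: derivative_eq_intros simp: power2_eq_square)
        qed
        have "(F has_real_derivative K t w) (at t within {r..1})"
          unfolding F_def K_def using t0
          by (auto intro!: derivative_eq_intros dq uv simp: field_simps power2_eq_square power3_eq_cube)
        then show "(F has_vector_derivative K t w) (at t within {r..1})"
          by (simp add: has_real_derivative_iff_has_vector_derivative)
      next
        have q: "continuous_on {r..1} (\<lambda>t. q (x / t))" if "continuous_on UNIV q" for q :: "real \<Rightarrow> real" and x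
          using r by (auto intro!: continuous_on_compose2[OF that] continuous_intros)
        show "continuous_on {r..1} (\<lambda>t. K t w)"
          unfolding K_def using r
          by (intro continuous_intros q[OF sm(1)] q[OF sm(2)] q[OF sm(3)] q[OF sm(4)]) auto
      qed (use r in auto)
      then show ?thesis by (simp add: F_def \<phi>_def divide_inverse mult_ac)
    qed
    have \<phi>c: "continuous_on A \<phi>" for A
      unfolding \<phi>_def by (intro continuous_on_mult continuous_on_compose2[OF sm(1)] continuous_on_compose2[OF sm(2)]
          continuous_intros) auto
    then have [measurable]: "\<phi> \<in> borel_measurable borel" by (intro borel_measurable_continuous_onI)
    have \<phi>0: "\<phi> z = 0" if "z \<notin> cbox (Complex a c) (Complex b d)" for z
      using that u0 v0 by (force simp: \<phi>_def in_cbox_complex_iff)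
    have \<phi>b: "\<exists>C. \<forall>z. \<bar>\<phi> z\<bar> \<le> C"
    proof -
      have "bounded (\<phi> ` cbox (Complex a c) (Complex b d))"
        by (intro compact_imp_bounded compact_continuous_image \<phi>c) auto
      then obtain C where C: "\<And>z. z \<in> cbox (Complex a c) (Complex b d) \<Longrightarrow> \<bar>\<phi> z\<bar> \<le> C"
        unfolding bounded_iff by auto
      have "\<bar>\<phi> z\<bar> \<le> \<bar>C\<bar>" for z
        using C[of z] \<phi>0[of z] by (cases "z \<in> cbox (Complex a c) (Complex b d)") auto
      then show ?thesis by blast
    qed
    then obtain C where C: "\<And>z. \<bar>\<phi> z\<bar> \<le> C" by blast
    have mb: "integrable M (\<lambda>x. of_real (\<phi> (k x)) * Q x)" if "integrable M Q" "k \<in> borel_measurable M"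
      for M :: "'b measure" and Q :: "'b \<Rightarrow> complex" and k
    proof (rule Bochner_Integration.integrable_bound)
      show "integrable M (\<lambda>x. C *\<^sub>R Q x)" using that by auto
      have [measurable]: "k \<in> borel_measurable M" "Q \<in> borel_measurable M" using that by auto
      show "(\<lambda>x. of_real (\<phi> (k x)) * Q x) \<in> borel_measurable M" by measurable
      have "norm (of_real (\<phi> (k x)) * Q x) \<le> norm (C *\<^sub>R Q x)" for x
        using C[of "k x"] by (simp add: norm_mult mult_right_mono)
      then show "AE x in M. norm (of_real (\<phi> (k x)) * Q x) \<le> norm (C *\<^sub>R Q x)" by simp
    qed
    have \<phi>W: "integrable lborel (\<lambda>z. of_real (\<phi> z) * W z)"
      and \<phi>Wr: "integrable lborel (\<lambda>z. of_real (\<phi> z) * W (r *\<^sub>R z))"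
      and \<phi>Wr': "integrable lborel (\<lambda>z. of_real (\<phi> (z /\<^sub>R r)) * W z)"
      and \<phi>G: "integrable lborel (\<lambda>z. of_real (\<phi> z) * G z)"
      using mb[OF int(1), of "\<lambda>z. z"] mb[OF Wr, of "\<lambda>z. z"] mb[OF int(1), of "\<lambda>z. z /\<^sub>R r"] mb[OF G, of "\<lambda>z. z"] by auto
    have \<phi>g: "integrable (lborel \<Otimes>\<^sub>M lborel) (\<lambda>(t::real, z). indicator {r..1} t *\<^sub>R (of_real (\<phi> z) * ((1 / t) *\<^sub>R g (t *\<^sub>R z))))"
    proof -
      have "integrable (lborel \<Otimes>\<^sub>M lborel) (\<lambda>x::real \<times> complex. of_real (\<phi> (snd x)) * (case x of (t, z) \<Rightarrow> indicator {r..1} t *\<^sub>R ((1 / t) *\<^sub>R g (t *\<^sub>R z))))"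
        by (rule mb[OF gd]) simp
      then show ?thesis by (simp add: case_prod_beta' mult_scaleR_right)
    qed
    have "(\<integral>z. of_real (\<phi> z) * W z - of_real (\<phi> z) * W (r *\<^sub>R z) \<partial>lborel)
        = (\<integral>z. of_real (\<phi> z) * W z \<partial>lborel) - (\<integral>z. of_real (\<phi> z) * W (r *\<^sub>R z) \<partial>lborel)"
      by (intro Bochner_Integration.integral_diff \<phi>W \<phi>Wr)
    also have "(\<integral>z. of_real (\<phi> z) * W (r *\<^sub>R z) \<partial>lborel) = (1 / r\<^sup>2) *\<^sub>R (\<integral>z. of_real (\<phi> (z /\<^sub>R r)) * W z \<partial>lborel)"
      using integral_lborel_scaleR[of "\<lambda>z. of_real (\<phi> (z /\<^sub>R r)) * W z" r] r by simp
    also have "(\<integral>z. of_real (\<phi> z) * W z \<partial>lborel) - \<dots> = (\<integral>z. of_real (\<phi> z) * W z - (1 / r\<^sup>2) *\<^sub>R (of_real (\<phi> (z /\<^sub>R r)) * W z) \<partial>lborel)"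
      using \<phi>W \<phi>Wr' by (subst Bochner_Integration.integral_diff) auto
    also have "\<dots> = (\<integral>w. W w * of_real (\<phi> w - \<phi> (w /\<^sub>R r) / r\<^sup>2) \<partial>lborel)"
      by (intro Bochner_Integration.integral_cong) (auto simp: scaleR_conv_of_real algebra_simps)
    also have "\<dots> = (\<integral>w. \<integral>t. indicator {r..1} t *\<^sub>R (W w * of_real (K t w)) \<partial>lborel \<partial>lborel)"
    proof (rule Bochner_Integration.integral_cong[OF refl])
      fix w
      have "(\<integral>t. indicator {r..1} t *\<^sub>R (W w * of_real (K t w)) \<partial>lborel) = (\<integral>t. W w * of_real (indicator {r..1} t *\<^sub>R K t w) \<partial>lborel)"
        by (intro Bochner_Integration.integral_cong) (auto simp: scaleR_conv_of_real)
      then show "W w * of_real (\<phi> w - \<phi> (w /\<^sub>R r) / r\<^sup>2) = (\<integral>t. indicator {r..1} t *\<^sub>R (W w * of_real (K t w)) \<partial>lborel)"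
        unfolding FTC[symmetric] by (simp only: integral_mult_right_zero integral_complex_of_real)
    qed
    also have "\<dots> = (\<integral>t. \<integral>w. indicator {r..1} t *\<^sub>R (W w * of_real (K t w)) \<partial>lborel \<partial>lborel)"
      by (rule lborel_pair.Fubini_integral[OF WK])
    also have "\<dots> = (\<integral>t. \<integral>z. indicator {r..1} t *\<^sub>R (of_real (\<phi> z) * ((1 / t) *\<^sub>R g (t *\<^sub>R z))) \<partial>lborel \<partial>lborel)"
    proof (rule Bochner_Integration.integral_cong[OF refl])
      fix t :: real
      show "(\<integral>w. indicator {r..1} t *\<^sub>R (W w * of_real (K t w)) \<partial>lborel)
          = (\<integral>z. indicator {r..1} t *\<^sub>R (of_real (\<phi> z) * ((1 / t) *\<^sub>R g (t *\<^sub>R z))) \<partial>lborel)"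
      proof (cases "t \<in> {r..1}")
        case True
        then have t: "0 < t" "t \<le> 1" using r by auto
        have "(\<integral>w. W w * of_real (K t w) \<partial>lborel)
            = (\<integral>z. of_real (\<phi> z) * ((1 / t) *\<^sub>R g (t *\<^sub>R z)) \<partial>lborel)"
          unfolding K_def \<phi>_def g_def
          by (rule weak_radial_derivative[of W X Y u v a b c d t])
            (rule int W0 X0 Y0 wX wY uv u0 v0 sub t; assumption)+
        then show ?thesis by (simp only: integral_scaleR_right)
      qed simp
    qed
    also have "\<dots> = (\<integral>z. \<integral>t. indicator {r..1} t *\<^sub>R (of_real (\<phi> z) * ((1 / t) *\<^sub>R g (t *\<^sub>R z))) \<partial>lborel \<partial>lborel)"
      by (rule lborel_pair.Fubini_integral[symmetric, OF \<phi>g])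
    also have "\<dots> = (\<integral>z. of_real (\<phi> z) * G z \<partial>lborel)"
      unfolding G_def by (simp add: mult_scaleR_right[symmetric] del: mult_scaleR_right)
    finally have eq: "(\<integral>z. of_real (\<phi> z) * W z - of_real (\<phi> z) * W (r *\<^sub>R z) \<partial>lborel) = (\<integral>z. of_real (\<phi> z) * G z \<partial>lborel)" .
    have "(\<integral>z. (W z - W (r *\<^sub>R z) - G z) * of_real (u (Re z) * v (Im z)) \<partial>lborel)
        = (\<integral>z. (of_real (\<phi> z) * W z - of_real (\<phi> z) * W (r *\<^sub>R z)) - of_real (\<phi> z) * G z \<partial>lborel)"
      by (intro Bochner_Integration.integral_cong) (auto simp: \<phi>_def algebra_simps)
    also have "\<dots> = 0"
      using \<phi>W \<phi>Wr \<phi>G eq by (subst Bochner_Integration.integral_diff) auto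
    finally show "(\<integral>z. (W z - W (r *\<^sub>R z) - G z) * of_real (u (Re z) * v (Im z)) \<partial>lborel) = 0" .
  qed
  then show ?thesis by eventually_elim (auto simp: G_def)
qed

text \<open>The exponents add up as follows. Jensen on an interval of length 1 - r gives
  \<open>(1 - r) powr (p - 1)\<close>, and integrating over t afterwards gives the remaining factor
  1 - r. The weight 1/t contributes \<open>r powr (- p)\<close> and the Jacobian of the dilation at
  most r^(-2).\<close>

lemma powr_norm_dilation_difference_le:
  fixes W X Y :: "complex \<Rightarrow> complex"
  assumes int: "integrable lborel W" "integrable lborel X" "integrable lborel Y"
    and W0: "\<And>z. z \<notin> unit_disk \<Longrightarrow> W z = 0"
    and X0: "\<And>z. z \<notin> unit_disk \<Longrightarrow> X z = 0" and Y0: "\<And>z. z \<notin> unit_disk \<Longrightarrow> Y z = 0"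
    and wX: "\<And>\<phi>. \<phi> \<in> test_functions \<Longrightarrow> (\<integral>z. W z * of_real (dir_deriv \<phi> 1 z) \<partial>lborel) = - (\<integral>z. X z * of_real (\<phi> z) \<partial>lborel)"
    and wY: "\<And>\<phi>. \<phi> \<in> test_functions \<Longrightarrow> (\<integral>z. W z * of_real (dir_deriv \<phi> \<i> z) \<partial>lborel) = - (\<integral>z. Y z * of_real (\<phi> z) \<partial>lborel)"
    and r: "0 < r" "r < 1" and p: "1 \<le> p"
  defines "g \<equiv> \<lambda>w. Re w *\<^sub>R X w + Im w *\<^sub>R Y w"
  shows "(\<integral>\<^sup>+z. indicator unit_disk z * ennreal (norm (W z - W (r *\<^sub>R z)) powr p) \<partial>lborel)
    \<le> ennreal ((1 - r) powr p * r powr (- p - 2)) * (\<integral>\<^sup>+z. ennreal (norm (g z) powr p) \<partial>lborel)"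
    (is "_ \<le> _ * ?I")
proof -
  have [measurable]: "W \<in> borel_measurable borel" "X \<in> borel_measurable borel" "Y \<in> borel_measurable borel"
    using int by auto
  have [measurable]: "g \<in> borel_measurable borel" unfolding g_def by measurable
  define G where "G z = (\<integral>t. indicator {r..1} t *\<^sub>R ((1 / t) *\<^sub>R g (t *\<^sub>R z)) \<partial>lborel)" for z
  \<comment> \<open>Lebesgue measure restricted to \<open>{r..1}\<close>, of total mass 1 - r, to
    which the Jensen bound is applied.\<close>
  define N where "N = density lborel (indicator {r..1} :: real \<Rightarrow> ennreal)"
  have [measurable_cong]: "sets N = sets borel" by (simp add: N_def)
  have sN: "emeasure N (space N) = ennreal (1 - r)"
    using r by (simp add: N_def emeasure_density)
  interpret N: finite_measure N by standard (simp add: sN)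
  have mN: "measure N (space N) = 1 - r" using sN r by (simp add: measure_def)
  have N_nn: "(\<integral>\<^sup>+t. h t \<partial>N) = (\<integral>\<^sup>+t. indicator {r..1} t * h t \<partial>lborel)" if "h \<in> borel_measurable borel" for h
    using that by (simp add: N_def nn_integral_density)
  have ind_density: "(indicator {r..1} :: real \<Rightarrow> ennreal) = (\<lambda>t. ennreal (indicator {r..1} t))"
    by (auto simp: indicator_def)
  have N_int: "integrable N h \<longleftrightarrow> integrable lborel (\<lambda>t. indicator {r..1} t *\<^sub>R h t)"
    and N_integral: "(\<integral>t. h t \<partial>N) = (\<integral>t. indicator {r..1} t *\<^sub>R h t \<partial>lborel)"
    if "h \<in> borel_measurable borel" for h :: "real \<Rightarrow> real"
    using that unfolding N_def ind_density by (auto simp: integrable_density integral_density)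
  have Gle: "ennreal (norm (G z) powr p) \<le> ennreal ((1 - r) powr (p - 1) * r powr (- p)) *
      (\<integral>\<^sup>+t. indicator {r..1} t * ennreal (norm (g (t *\<^sub>R z)) powr p) \<partial>lborel)" for z
  proof (cases "integrable lborel (\<lambda>t. indicator {r..1} t *\<^sub>R ((1 / t) *\<^sub>R g (t *\<^sub>R z)))")
    case True
    define k where "k t = norm ((1 / t) *\<^sub>R g (t *\<^sub>R z))" for t
    have [measurable]: "k \<in> borel_measurable borel" unfolding k_def by measurable
    have "integrable lborel (\<lambda>t. norm (indicator {r..1} t *\<^sub>R ((1 / t) *\<^sub>R g (t *\<^sub>R z))))"
      using True by (rule integrable_norm)
    then have kN: "integrable N k"
      by (subst N_int) (auto simp: k_def)
    have "norm (G z) \<le> (\<integral>t. norm (indicator {r..1} t *\<^sub>R ((1 / t) *\<^sub>R g (t *\<^sub>R z))) \<partial>lborel)"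
      unfolding G_def by (rule integral_norm_bound)
    also have "\<dots> = (\<integral>t. k t \<partial>N)"
      by (subst N_integral) (auto simp: k_def)
    finally have "ennreal (norm (G z) powr p) \<le> ennreal ((\<integral>t. k t \<partial>N) powr p)"
      using p by (intro ennreal_leI powr_mono2) auto
    also have "\<dots> \<le> ennreal ((1 - r) powr (p - 1)) * (\<integral>\<^sup>+t. ennreal (k t powr p) \<partial>N)"
      using N.powr_integral_le[OF p kN] r by (simp add: mN k_def)
    also have "(\<integral>\<^sup>+t. ennreal (k t powr p) \<partial>N) = (\<integral>\<^sup>+t. indicator {r..1} t * ennreal (k t powr p) \<partial>lborel)"
      by (rule N_nn) measurable
    also have "\<dots> \<le> (\<integral>\<^sup>+t. ennreal (r powr (- p)) * (indicator {r..1} t * ennreal (norm (g (t *\<^sub>R z)) powr p)) \<partial>lborel)"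
    proof (rule nn_integral_mono)
      fix t
      show "indicator {r..1} t * ennreal (k t powr p) \<le> ennreal (r powr (- p)) * (indicator {r..1} t * ennreal (norm (g (t *\<^sub>R z)) powr p))"
      proof (cases "t \<in> {r..1}")
        case True
        then have t: "r \<le> t" "0 < t" using r by auto
        have "k t = norm (g (t *\<^sub>R z)) / t" using t by (simp add: k_def)
        then have "k t powr p = t powr (- p) * norm (g (t *\<^sub>R z)) powr p"
          using t by (simp add: powr_divide powr_minus_divide[of t p])
        also have "\<dots> \<le> r powr (- p) * norm (g (t *\<^sub>R z)) powr p"
          using t r p by (intro mult_right_mono powr_mono2') auto
        finally show ?thesis using True by (simp add: ennreal_mult'[symmetric] ennreal_leI)
      qed simp
    qed
    also have "\<dots> = ennreal (r powr (- p)) * (\<integral>\<^sup>+t. indicator {r..1} t * ennreal (norm (g (t *\<^sub>R z)) powr p) \<partial>lborel)"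
      by (rule nn_integral_cmult) measurable
    finally show ?thesis
      by (simp add: ennreal_mult mult.assoc mult_left_mono)
  next
    \<comment> \<open>A non-integrable integrand has Bochner integral 0 by convention, so the bound
      holds at every z, exceptional ones included.\<close>
    case False
    then have "G z = 0" unfolding G_def by (rule not_integrable_integral_eq)
    then show ?thesis by simp
  qed
  have "AE z in lborel. z \<in> unit_disk \<longrightarrow> W z - W (r *\<^sub>R z) = G z"
    unfolding G_def g_def
    by (rule dilation_difference_eq) (rule int W0 X0 Y0 wX wY r; assumption)+
  then have "(\<integral>\<^sup>+z. indicator unit_disk z * ennreal (norm (W z - W (r *\<^sub>R z)) powr p) \<partial>lborel)
      = (\<integral>\<^sup>+z. indicator unit_disk z * ennreal (norm (G z) powr p) \<partial>lborel)"
    by (intro nn_integral_cong_AE) (auto simp: indicator_def)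
  also have "\<dots> \<le> (\<integral>\<^sup>+z. ennreal ((1 - r) powr (p - 1) * r powr (- p)) *
      (\<integral>\<^sup>+t. indicator {r..1} t * ennreal (norm (g (t *\<^sub>R z)) powr p) \<partial>lborel) \<partial>lborel)"
  proof (rule nn_integral_mono)
    fix z
    show "indicator unit_disk z * ennreal (norm (G z) powr p) \<le> ennreal ((1 - r) powr (p - 1) * r powr (- p)) *
      (\<integral>\<^sup>+t. indicator {r..1} t * ennreal (norm (g (t *\<^sub>R z)) powr p) \<partial>lborel)"
      using Gle[of z] by (cases "z \<in> unit_disk") auto
  qed
  also have "\<dots> = ennreal ((1 - r) powr (p - 1) * r powr (- p)) *
      (\<integral>\<^sup>+z. \<integral>\<^sup>+t. indicator {r..1} t * ennreal (norm (g (t *\<^sub>R z)) powr p) \<partial>lborel \<partial>lborel)"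
    by (rule nn_integral_cmult) measurable
  also have "(\<integral>\<^sup>+z. \<integral>\<^sup>+t. indicator {r..1} t * ennreal (norm (g (t *\<^sub>R z)) powr p) \<partial>lborel \<partial>lborel)
      = (\<integral>\<^sup>+t. \<integral>\<^sup>+z. indicator {r..1} t * ennreal (norm (g (t *\<^sub>R z)) powr p) \<partial>lborel \<partial>lborel)"
    by (rule lborel_pair.Fubini') measurable
  also have "ennreal ((1 - r) powr (p - 1) * r powr (- p)) *
      (\<integral>\<^sup>+t. \<integral>\<^sup>+z. indicator {r..1} t * ennreal (norm (g (t *\<^sub>R z)) powr p) \<partial>lborel \<partial>lborel)
      \<le> ennreal ((1 - r) powr (p - 1) * r powr (- p)) *
      (\<integral>\<^sup>+t. indicator {r..1} t * (ennreal (1 / r ^ 2) * ?I) \<partial>lborel)"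
  proof (rule mult_left_mono, rule nn_integral_mono)
    fix t :: real
    show "(\<integral>\<^sup>+z. indicator {r..1} t * ennreal (norm (g (t *\<^sub>R z)) powr p) \<partial>lborel)
        \<le> indicator {r..1} t * (ennreal (1 / r ^ 2) * ?I)"
    proof (cases "t \<in> {r..1}")
      case True
      then have t: "r \<le> t" "0 < t" using r by auto
      let ?J = "\<integral>\<^sup>+z. ennreal (norm (g (t *\<^sub>R z)) powr p) \<partial>lborel"
      have "?J = ennreal (1 / t ^ 2) * (ennreal (t ^ 2) * ?J)"
        using t by (simp add: mult.assoc[symmetric] ennreal_mult'[symmetric])
      also have "ennreal (t ^ 2) * ?J = ?I"
        using nn_integral_lborel_scaleR[of "\<lambda>z. ennreal (norm (g z) powr p)" t] t by simp
      also have "ennreal (1 / t ^ 2) * ?I \<le> ennreal (1 / r ^ 2) * ?I"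
        using t r by (intro mult_right_mono ennreal_leI divide_left_mono power_mono) auto
      finally show ?thesis using True by simp
    qed simp
  qed simp
  also have "(\<integral>\<^sup>+t. indicator {r..1} t * (ennreal (1 / r ^ 2) * ?I) \<partial>lborel) = ennreal (1 - r) * (ennreal (1 / r ^ 2) * ?I)"
    using r by (simp add: nn_integral_multc)
  also have "ennreal ((1 - r) powr (p - 1) * r powr (- p)) * (ennreal (1 - r) * (ennreal (1 / r ^ 2) * ?I))
      = ennreal ((1 - r) powr p * r powr (- p - 2)) * ?I"
  proof -
    have "(1 - r) powr (p - 1) * r powr (- p) * ((1 - r) * (1 / r ^ 2)) = (1 - r) powr p * r powr (- p - 2)"
      using r by (simp add: powr_diff powr_minus field_simps)
    then show ?thesis
      using r by (simp add: mult.assoc[symmetric] ennreal_mult'[symmetric])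
  qed
  finally show ?thesis .
qed

text \<open>The competitor \<open>F (r z)\<close> is split as \<open>W (r z) - F (r z)\<close>, whose \<open>p\<close>-th power integrates over the smaller disk of
  radius \<open>r\<close>, plus \<open>W z - W (r z)\<close>; the convexity weights \<open>r\<close> and \<open>1 - r\<close> lose only \<open>O(1 - r)\<close>.\<close>

lemma annulus_integral_le:
  fixes W F :: "complex \<Rightarrow> complex"
  assumes [measurable]: "W \<in> borel_measurable borel" "F \<in> borel_measurable borel"
    and p: "1 \<le> p" and r: "0 < r" "r < 1" and C: "0 \<le> C" and m: "0 \<le> m"
    and fin: "(\<integral>\<^sup>+z. indicator unit_disk z * ennreal (norm (W z - F z) powr p) \<partial>lborel) = ennreal m"
    and dil: "(\<integral>\<^sup>+z. indicator unit_disk z * ennreal (norm (W z - W (r *\<^sub>R z)) powr p) \<partial>lborel) \<le> ennreal (C * (1 - r) powr p)"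
    and min: "(\<integral>\<^sup>+z. indicator unit_disk z * ennreal (norm (W z - F z) powr p) \<partial>lborel)
      \<le> (\<integral>\<^sup>+z. indicator unit_disk z * ennreal (norm (W z - F (r *\<^sub>R z)) powr p) \<partial>lborel)"
  shows "(\<integral>\<^sup>+z. indicator {z. r < norm z \<and> norm z < 1} z * ennreal (norm (W z - F z) powr p) \<partial>lborel)
      \<le> ennreal (((1 + p) * m + C) * (1 - r))"
proof -
  define h where "h z = ennreal (norm (W z - F z) powr p)" for z
  have [measurable]: "h \<in> borel_measurable borel" unfolding h_def by measurable
  \<comment> \<open>The circle of radius \<open>r\<close> is included so that \<open>A\<close> and
    \<open>ball 0 r\<close> partition the disk; the smaller set in the claim is reached by
    monotonicity at the end.\<close>
  define A where "A = {z::complex. r \<le> norm z \<and> norm z < 1}"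
  have [measurable]: "A \<in> sets borel" unfolding A_def by measurable
  have [measurable]: "ball (0::complex) r \<in> sets borel" by simp
  have split: "indicator unit_disk z * h z = indicator (ball 0 r) z * h z + indicator A z * h z" for z
    using r by (auto simp: A_def indicator_def)
  have sum: "(\<integral>\<^sup>+z. indicator (ball 0 r) z * h z \<partial>lborel) + (\<integral>\<^sup>+z. indicator A z * h z \<partial>lborel) = ennreal m"
  proof -
    have "(\<integral>\<^sup>+z. indicator (ball 0 r) z * h z + indicator A z * h z \<partial>lborel)
        = (\<integral>\<^sup>+z. indicator (ball 0 r) z * h z \<partial>lborel) + (\<integral>\<^sup>+z. indicator A z * h z \<partial>lborel)"
      by (intro nn_integral_add borel_measurable_times_ennreal borel_measurable_indicator) simp_all
    then show ?thesis using fin unfolding h_def[symmetric] split by simp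
  qed
  obtain a where a: "(\<integral>\<^sup>+z. indicator (ball 0 r) z * h z \<partial>lborel) = ennreal a" "0 \<le> a"
    using sum by (cases "\<integral>\<^sup>+z. indicator (ball 0 r) z * h z \<partial>lborel") auto
  obtain b where b: "(\<integral>\<^sup>+z. indicator A z * h z \<partial>lborel) = ennreal b" "0 \<le> b"
    using sum by (cases "\<integral>\<^sup>+z. indicator A z * h z \<partial>lborel") auto
  have ab: "a + b = m"
    using sum a b m by (simp add: ennreal_plus[symmetric] del: ennreal_plus)
  have scaled: "(\<integral>\<^sup>+z. indicator unit_disk z * h (r *\<^sub>R z) \<partial>lborel) = ennreal (a / r\<^sup>2)"
  proof -
    have "ennreal a = ennreal (r ^ DIM(complex)) * (\<integral>\<^sup>+z. indicator (ball 0 r) (r *\<^sub>R z) * h (r *\<^sub>R z) \<partial>lborel)"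
      unfolding a(1)[symmetric] by (rule nn_integral_lborel_scaleR) (use r in auto)
    also have "(\<integral>\<^sup>+z. indicator (ball 0 r) (r *\<^sub>R z) * h (r *\<^sub>R z) \<partial>lborel) = (\<integral>\<^sup>+z. indicator unit_disk z * h (r *\<^sub>R z) \<partial>lborel)"
      using r by (intro nn_integral_cong) (auto simp: indicator_def)
    finally have "ennreal (1 / r\<^sup>2) * ennreal a = ennreal (1 / r\<^sup>2) * (ennreal (r\<^sup>2) * (\<integral>\<^sup>+z. indicator unit_disk z * h (r *\<^sub>R z) \<partial>lborel))"
      by simp
    then show ?thesis
      using r a(2) by (simp add: mult.assoc[symmetric] ennreal_mult'[symmetric])
  qed
  have "ennreal m \<le> (\<integral>\<^sup>+z. indicator unit_disk z * ennreal (norm (W z - F (r *\<^sub>R z)) powr p) \<partial>lborel)"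
    using min unfolding fin .
  also have "\<dots> \<le> (\<integral>\<^sup>+z. ennreal (r powr (1 - p)) * (indicator unit_disk z * h (r *\<^sub>R z)) +
      ennreal ((1 - r) powr (1 - p)) * (indicator unit_disk z * ennreal (norm (W z - W (r *\<^sub>R z)) powr p)) \<partial>lborel)"
  proof (rule nn_integral_mono)
    fix z
    have "norm (W z - F (r *\<^sub>R z)) powr p \<le> r powr (1 - p) * norm (W (r *\<^sub>R z) - F (r *\<^sub>R z)) powr p
        + (1 - r) powr (1 - p) * norm (W z - W (r *\<^sub>R z)) powr p"
      using norm_add_powr_le_weighted[OF p r, of "W (r *\<^sub>R z) - F (r *\<^sub>R z)" "W z - W (r *\<^sub>R z)"]
      by simp
    then have "ennreal (norm (W z - F (r *\<^sub>R z)) powr p) \<le> ennreal (r powr (1 - p)) * h (r *\<^sub>R z) +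
        ennreal ((1 - r) powr (1 - p)) * ennreal (norm (W z - W (r *\<^sub>R z)) powr p)"
      unfolding h_def by (simp add: ennreal_mult'[symmetric] ennreal_plus[symmetric] ennreal_leI del: ennreal_plus)
    then show "indicator unit_disk z * ennreal (norm (W z - F (r *\<^sub>R z)) powr p) \<le>
        ennreal (r powr (1 - p)) * (indicator unit_disk z * h (r *\<^sub>R z)) +
        ennreal ((1 - r) powr (1 - p)) * (indicator unit_disk z * ennreal (norm (W z - W (r *\<^sub>R z)) powr p))"
      by (cases "z \<in> unit_disk") simp_all
  qed
  also have "\<dots> = ennreal (r powr (1 - p)) * ennreal (a / r\<^sup>2) + ennreal ((1 - r) powr (1 - p)) *
      (\<integral>\<^sup>+z. indicator unit_disk z * ennreal (norm (W z - W (r *\<^sub>R z)) powr p) \<partial>lborel)"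
  proof -
    have [measurable]: "(\<lambda>z. indicator unit_disk z * h (r *\<^sub>R z)) \<in> borel_measurable lborel"
      "(\<lambda>z. indicator unit_disk z * ennreal (norm (W z - W (r *\<^sub>R z)) powr p)) \<in> borel_measurable lborel"
      by (intro borel_measurable_times_ennreal borel_measurable_indicator; measurable)+
    show ?thesis
      unfolding scaled[symmetric]
      by (subst nn_integral_add, measurable, subst nn_integral_cmult, measurable, subst nn_integral_cmult, measurable)
  qed
  also have "\<dots> \<le> ennreal (r powr (1 - p)) * ennreal (a / r\<^sup>2) + ennreal ((1 - r) powr (1 - p)) * ennreal (C * (1 - r) powr p)"
    by (intro add_left_mono mult_left_mono dil) auto
  also have "\<dots> = ennreal (r powr (1 - p) * (a / r\<^sup>2) + (1 - r) powr (1 - p) * (C * (1 - r) powr p))"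
    using a C by (simp add: ennreal_mult'[symmetric] ennreal_plus[symmetric] del: ennreal_plus)
  finally have le: "m \<le> r powr (1 - p) * (a / r\<^sup>2) + (1 - r) powr (1 - p) * (C * (1 - r) powr p)"
    using a(2) C by (subst (asm) ennreal_le_iff) auto
  \<comment> \<open>The reason for the weight 1 - r: the exponents 1 - p and p add up to 1, leaving
    an error linear in 1 - r for every \<open>p\<close>.\<close>
  have e1: "(1 - r) powr (1 - p) * (C * (1 - r) powr p) = C * (1 - r)"
    using r by (simp add: powr_diff)
  have e2: "r powr (1 - p) * (a / r\<^sup>2) = a / r powr (1 + p)"
    using r by (simp add: powr_diff powr_add power2_eq_square)
  have "m \<le> a / r powr (1 + p) + C * (1 - r)" using le unfolding e1 e2 .
  then have "m * r powr (1 + p) \<le> (a / r powr (1 + p) + C * (1 - r)) * r powr (1 + p)"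
    by (intro mult_right_mono) auto
  also have "\<dots> = a + C * (1 - r) * r powr (1 + p)"
    using r by (simp add: distrib_right)
  also have "\<dots> \<le> a + C * (1 - r) * 1"
    using r C p by (intro add_left_mono mult_left_mono) (auto intro!: powr_le1)
  finally have 1: "m * r powr (1 + p) \<le> a + C * (1 - r)" by simp
  \<comment> \<open>Bernoulli's inequality for the exponent 1 + p, as a case of Young's. It bounds 1
    - r^(1+p) by (1 + p)(1 - r), the source of the coefficient of \<open>m\<close>.\<close>
  have "(1 + p) * (1 powr ((1 + p) - 1) * r) \<le> (1 + p) * (((1 + p) - 1) / (1 + p) * 1 powr (1 + p) + 1 / (1 + p) * r powr (1 + p))"
    using young_powr[of "1 + p" r 1] p r by (intro mult_left_mono) auto
  also have "\<dots> = p + r powr (1 + p)" using p by (simp add: distrib_left)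
  finally have "1 - (1 + p) * (1 - r) \<le> r powr (1 + p)" by (simp add: algebra_simps)
  moreover have "m * (1 - x) = m - m * x" for x by (simp add: right_diff_distrib)
  ultimately have "m - m * ((1 + p) * (1 - r)) \<le> m * r powr (1 + p)"
    using m by (metis mult_left_mono)
  then have "b \<le> ((1 + p) * m + C) * (1 - r)"
    using 1 ab by (simp add: algebra_simps)
  then have "(\<integral>\<^sup>+z. indicator A z * h z \<partial>lborel) \<le> ennreal (((1 + p) * m + C) * (1 - r))"
    unfolding b(1) by (rule ennreal_leI)
  moreover have "(\<integral>\<^sup>+z. indicator {z. r < norm z \<and> norm z < 1} z * h z \<partial>lborel) \<le> (\<integral>\<^sup>+z. indicator A z * h z \<partial>lborel)"
    by (intro nn_integral_mono mult_right_mono) (auto simp: A_def indicator_def)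
  ultimately show ?thesis unfolding h_def by (rule order_trans[rotated])
qed

section \<open>Normalized area\<close>

lemma area_eq_density: "area = density (lebesgue_on unit_disk) (\<lambda>_. ennreal (1 / pi))"
  unfolding area_def by (rule measure_eqI) (auto simp: emeasure_density nn_integral_cmult_indicator)

lemma unit_disk_lebesgue [measurable]: "unit_disk \<in> sets lebesgue" "unit_disk \<in> sets borel"
  by auto

lemma sets_area [measurable_cong]: "sets area = sets (lebesgue_on unit_disk)"
  by (simp add: area_def)

lemma AE_area_iff: "(AE z in area. P z) \<longleftrightarrow> (AE z in lborel. z \<in> unit_disk \<longrightarrow> P z)"
  unfolding area_eq_density
  by (subst AE_density) (auto simp: AE_restrict_space_iff AE_completion_iff)

lemma borel_measurable_area: "h \<in> borel_measurable borel \<Longrightarrow> h \<in> borel_measurable area"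
  unfolding measurable_cong_sets[OF sets_area refl]
  by (intro measurable_restrict_space1 measurable_completion) simp

lemma nn_integral_area:
  assumes [measurable]: "h \<in> borel_measurable borel"
  shows "(\<integral>\<^sup>+z. h z \<partial>area) = ennreal (1 / pi) * (\<integral>\<^sup>+z. indicator unit_disk z * h z \<partial>lborel)"
proof -
  have "h \<in> borel_measurable (lebesgue_on unit_disk)"
    by (intro measurable_restrict_space1 measurable_completion) simp
  then have "(\<integral>\<^sup>+z. h z \<partial>area) = ennreal (1 / pi) * (\<integral>\<^sup>+z. h z \<partial>lebesgue_on unit_disk)"
    unfolding area_def by (rule nn_integral_scale_measure)
  also have "(\<integral>\<^sup>+z. h z \<partial>lebesgue_on unit_disk) = (\<integral>\<^sup>+z. indicator unit_disk z * h z \<partial>lborel)"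
    by (subst nn_integral_restrict_space) (auto simp: nn_integral_completion mult.commute)
  finally show ?thesis .
qed

lemma integral_area:
  fixes h :: "complex \<Rightarrow> 'b::{banach, second_countable_topology}"
  assumes [measurable]: "h \<in> borel_measurable borel"
  shows "(\<integral>z. h z \<partial>area) = (1 / pi) *\<^sub>R (\<integral>z. indicator unit_disk z *\<^sub>R h z \<partial>lborel)"
proof -
  have "h \<in> borel_measurable (lebesgue_on unit_disk)"
    by (intro measurable_restrict_space1 measurable_completion) simp
  then have "(\<integral>z. h z \<partial>area) = (1 / pi) *\<^sub>R (\<integral>z. h z \<partial>lebesgue_on unit_disk)"
    unfolding area_eq_density by (subst integral_density) auto
  also have "(\<integral>z. h z \<partial>lebesgue_on unit_disk) = (\<integral>z. indicator unit_disk z *\<^sub>R h z \<partial>lebesgue)"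
    by (subst integral_restrict_space) auto
  also have "\<dots> = (\<integral>z. indicator unit_disk z *\<^sub>R h z \<partial>lborel)"
    by (rule integral_completion) measurable
  finally show ?thesis .
qed

interpretation area: finite_measure area
proof
  show "emeasure area (space area) \<noteq> \<infinity>"
    using emeasure_lborel_ball_finite[of "0::complex" 1]
    by (simp add: area_def space_scale_measure emeasure_restrict_space ennreal_mult_eq_top_iff)
qed

section \<open>Borel representatives and the passage from area measure to Lebesgue measure\<close>

lemma Lp_diff:
  assumes "1 \<le> p" "f \<in> Lp p" "g \<in> Lp p"
  shows "(\<lambda>z. f z - g z) \<in> Lp p"
proof -
  have [measurable]: "f \<in> borel_measurable area" "g \<in> borel_measurable area"
    and i: "integrable area (\<lambda>z. norm (f z) powr p)" "integrable area (\<lambda>z. norm (g z) powr p)"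
    using assms by (auto simp: Lp_def)
  have "integrable area (\<lambda>z. norm (f z - g z) powr p)"
  proof (rule Bochner_Integration.integrable_bound)
    show "integrable area (\<lambda>z. 2 powr (p - 1) * (norm (f z) powr p + norm (g z) powr p))"
      using i by auto
    show "AE z in area. norm (norm (f z - g z) powr p) \<le> norm (2 powr (p - 1) * (norm (f z) powr p + norm (g z) powr p))"
      using norm_add_powr_le[OF assms(1), of "f _" "- g _"] by (auto intro!: AE_I2)
  qed measurable
  then show ?thesis by (simp add: Lp_def)
qed

text \<open>Elements of \<open>Lp p\<close> are merely Lebesgue measurable on the disk and arbitrary
  outside, whereas the dilation and Fubini arguments work with Borel functions on the whole plane
  that vanish off the disk. Integrability holds because |W| is at most |W|^p + 1 on a set of finite
  area.\<close>

lemma Lp_borel_representative: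
  assumes p: "1 \<le> p" and f: "f \<in> Lp p"
  obtains W where "W \<in> borel_measurable borel" "\<And>z. z \<notin> unit_disk \<Longrightarrow> W z = 0" "AE z in area. f z = W z"
    "(\<integral>\<^sup>+z. ennreal (norm (W z) powr p) \<partial>lborel) < \<infinity>" "integrable lborel W"
proof -
  define F where "F z = indicator unit_disk z *\<^sub>R f z" for z
  have "f \<in> borel_measurable (lebesgue_on unit_disk)"
    using f by (simp add: Lp_def measurable_cong_sets[OF sets_area refl])
  then have F: "F \<in> borel_measurable lebesgue"
    unfolding F_def by (subst (asm) borel_measurable_restrict_space_iff) auto
  obtain R where R[measurable]: "R \<in> borel_measurable borel" and aeR: "AE z in lborel. Re (F z) = R z"
    using completion_ex_borel_measurable_real[of "\<lambda>z. Re (F z)" lborel] F by auto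
  obtain I where I[measurable]: "I \<in> borel_measurable borel" and aeI: "AE z in lborel. Im (F z) = I z"
    using completion_ex_borel_measurable_real[of "\<lambda>z. Im (F z)" lborel] F by auto
  have ae: "AE z in lborel. F z = Complex (R z) (I z)"
    using aeR aeI by eventually_elim (auto simp: complex_eq_iff)
  define W where "W z = indicator unit_disk z *\<^sub>R Complex (R z) (I z)" for z
  have W[measurable]: "W \<in> borel_measurable borel" unfolding W_def by measurable
  have W0: "W z = 0" if "z \<notin> unit_disk" for z using that by (simp add: W_def)
  have fW: "AE z in area. f z = W z"
    unfolding AE_area_iff using ae by eventually_elim (auto simp: F_def W_def)
  have "(\<integral>\<^sup>+z. ennreal (norm (f z) powr p) \<partial>area) < \<infinity>"
    using f by (auto simp: Lp_def integrable_iff_bounded)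
  also have "(\<integral>\<^sup>+z. ennreal (norm (f z) powr p) \<partial>area) = (\<integral>\<^sup>+z. ennreal (norm (W z) powr p) \<partial>area)"
    using fW by (intro nn_integral_cong_AE) auto
  also have "\<dots> = ennreal (1 / pi) * (\<integral>\<^sup>+z. indicator unit_disk z * ennreal (norm (W z) powr p) \<partial>lborel)"
    by (rule nn_integral_area) measurable
  also have "(\<integral>\<^sup>+z. indicator unit_disk z * ennreal (norm (W z) powr p) \<partial>lborel) = (\<integral>\<^sup>+z. ennreal (norm (W z) powr p) \<partial>lborel)"
    using W0 by (intro nn_integral_cong) (auto simp: indicator_def)
  finally have fin: "(\<integral>\<^sup>+z. ennreal (norm (W z) powr p) \<partial>lborel) < \<infinity>"
    using pi_gt_zero by (auto simp: ennreal_mult_less_top ennreal_eq_0_iff simp del: pi_gt_zero)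
  have "integrable lborel W"
  proof (rule Bochner_Integration.integrable_bound)
    have "integrable lborel (\<lambda>z. norm (W z) powr p)"
      using fin by (intro integrableI_bounded) auto
    moreover have "integrable lborel (indicator unit_disk :: complex \<Rightarrow> real)"
      using emeasure_lborel_ball_finite by (intro integrable_real_indicator) auto
    ultimately show "integrable lborel (\<lambda>z. norm (W z) powr p + indicator unit_disk z)" by auto
    have "norm (W z) \<le> norm (norm (W z) powr p + indicator unit_disk z)" for z
    proof (cases "z \<in> unit_disk")
      case True
      show ?thesis
      proof (cases "norm (W z) \<le> 1")
        case False
        then have "norm (W z) powr 1 \<le> norm (W z) powr p" using p by (intro powr_mono) auto
        then show ?thesis using True False by simp
      qed (use True in \<open>auto intro: order_trans\<close>)
    qed (simp add: W0)
    then show "AE z in lborel. norm (W z) \<le> norm (norm (W z) powr p + indicator unit_disk z)" by simp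
  qed measurable
  then show ?thesis using that W W0 fW fin by blast
qed

text \<open>Both integrals see the functions only up to null sets of the disk, and the normalization
  1/\<pi> occurs on both sides and cancels.\<close>

lemma weak_deriv_representative:
  assumes w: "weak_deriv v f g" and v: "v \<in> Basis" and fm: "f \<in> borel_measurable area" "g \<in> borel_measurable area"
    and W: "W \<in> borel_measurable borel" "\<And>z. z \<notin> unit_disk \<Longrightarrow> W z = 0" "AE z in area. f z = W z"
    and X: "X \<in> borel_measurable borel" "\<And>z. z \<notin> unit_disk \<Longrightarrow> X z = 0" "AE z in area. g z = X z"
    and \<phi>: "\<phi> \<in> test_functions"
  shows "(\<integral>z. W z * of_real (dir_deriv \<phi> v z) \<partial>lborel) = - (\<integral>z. X z * of_real (\<phi> z) \<partial>lborel)"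
proof -
  have "C_k 0 \<phi>" "C_k (Suc 0) \<phi>" using \<phi> unfolding test_functions_def by blast+
  then have [measurable]: "\<phi> \<in> borel_measurable borel" "dir_deriv \<phi> v \<in> borel_measurable borel"
    using v by (auto intro!: borel_measurable_continuous_onI)
  have conv: "(\<integral>z. k z * of_real (q z) \<partial>area) = (1 / pi) *\<^sub>R (\<integral>z. K z * of_real (q z) \<partial>lborel)"
    if [measurable]: "k \<in> borel_measurable area" "K \<in> borel_measurable borel" "q \<in> borel_measurable borel"
      and "\<And>z. z \<notin> unit_disk \<Longrightarrow> K z = 0" "AE z in area. k z = K z" for k K :: "complex \<Rightarrow> complex" and q :: "complex \<Rightarrow> real"
  proof -
    note [measurable] = borel_measurable_area[OF that(2)] borel_measurable_area[OF that(3)]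
    have "(\<integral>z. k z * of_real (q z) \<partial>area) = (\<integral>z. K z * of_real (q z) \<partial>area)"
      using that(5) by (intro integral_cong_AE) auto
    also have "\<dots> = (1 / pi) *\<^sub>R (\<integral>z. indicator unit_disk z *\<^sub>R (K z * of_real (q z)) \<partial>lborel)"
      by (rule integral_area) measurable
    also have "(\<integral>z. indicator unit_disk z *\<^sub>R (K z * of_real (q z)) \<partial>lborel) = (\<integral>z. K z * of_real (q z) \<partial>lborel)"
      using that(4) by (intro Bochner_Integration.integral_cong) (auto simp: indicator_def)
    finally show ?thesis .
  qed
  have "(1 / pi) *\<^sub>R (\<integral>z. W z * of_real (dir_deriv \<phi> v z) \<partial>lborel) = - ((1 / pi) *\<^sub>R (\<integral>z. X z * of_real (\<phi> z) \<partial>lborel))"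
    using w \<phi> conv[OF fm(1) W(1) _ W(2,3), of "dir_deriv \<phi> v"] conv[OF fm(2) X(1) _ X(2,3), of \<phi>]
    by (simp add: weak_deriv_def)
  then have "pi *\<^sub>R ((1 / pi) *\<^sub>R (\<integral>z. W z * of_real (dir_deriv \<phi> v z) \<partial>lborel))
      = pi *\<^sub>R (- ((1 / pi) *\<^sub>R (\<integral>z. X z * of_real (\<phi> z) \<partial>lborel)))" by simp
  then show ?thesis by simp
qed

section \<open>Dilated competitors, minimality and the final estimate\<close>

lemma dilation_in_bergman:
  assumes p: "1 \<le> p" and f: "f holomorphic_on unit_disk" and r: "0 < r" "r < 1"
  shows "(\<lambda>z. f (r *\<^sub>R z)) \<in> bergman p"
proof -
  have le: "norm (r *\<^sub>R z) \<le> r" if "z \<in> unit_disk" for z :: complex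
    using that r by (simp add: mult_left_le)
  have "(\<lambda>z. r *\<^sub>R z) ` unit_disk \<subseteq> unit_disk"
  proof (rule image_subsetI)
    fix z :: complex assume "z \<in> unit_disk"
    then have "norm (r *\<^sub>R z) < 1" using le[of z] r by linarith
    then show "r *\<^sub>R z \<in> unit_disk" by simp
  qed
  moreover have "(\<lambda>z::complex. r *\<^sub>R z) holomorphic_on unit_disk"
    unfolding scaleR_conv_of_real by (intro holomorphic_intros)
  ultimately have hol: "(\<lambda>z. f (r *\<^sub>R z)) holomorphic_on unit_disk"
    using holomorphic_on_compose_gen[OF _ f, of "\<lambda>z. r *\<^sub>R z" unit_disk] by (simp add: o_def)
  have m: "(\<lambda>z. f (r *\<^sub>R z)) \<in> borel_measurable area"
    unfolding measurable_cong_sets[OF sets_area refl]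
    by (intro continuous_imp_measurable_on_sets_lebesgue holomorphic_on_imp_continuous_on hol) auto
  \<comment> \<open>The dilation takes on the disk only values of \<open>f\<close> from the compact
    disk of radius \<open>r\<close>. It is therefore bounded, and the area is finite.\<close>
  have "bounded (f ` cball 0 r)"
    using r by (intro compact_imp_bounded compact_continuous_image
        continuous_on_subset[OF holomorphic_on_imp_continuous_on[OF f]]) auto
  then obtain B where B: "\<And>z. z \<in> cball 0 r \<Longrightarrow> norm (f z) \<le> B"
    unfolding bounded_iff by blast
  have "integrable area (\<lambda>z. norm (f (r *\<^sub>R z)) powr p)"
  proof (rule area.integrable_const_bound)
    show "AE z in area. norm (norm (f (r *\<^sub>R z)) powr p) \<le> B powr p"
    proof (rule AE_I2)
      fix z assume "z \<in> space area"
      then have "z \<in> unit_disk" by (simp add: area_def space_scale_measure)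
      then show "norm (norm (f (r *\<^sub>R z)) powr p) \<le> B powr p"
        using B[of "r *\<^sub>R z"] le[of z] p by (auto intro!: powr_mono2)
    qed
  qed (use m in measurable)
  then show ?thesis using hol m by (simp add: bergman_def Lp_def)
qed

text \<open>The power 1/p is strictly increasing, so comparing norms amounts to comparing integrals
  of p-th powers. Both differences lie in \<open>Lp p\<close>, hence the integrals are finite and
  agree with the nonnegative ones.\<close>

lemma best_approximant_nn_integral_le:
  assumes p: "1 \<le> p" and w: "\<omega> \<in> Lp p" and f: "best_approximant p \<omega> f" and g: "g \<in> bergman p"
  shows "(\<integral>\<^sup>+z. ennreal (norm (\<omega> z - f z) powr p) \<partial>area) \<le> (\<integral>\<^sup>+z. ennreal (norm (\<omega> z - g z) powr p) \<partial>area)"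
proof -
  have fL: "f \<in> Lp p" and gL: "g \<in> Lp p" using f g by (auto simp: best_approximant_def bergman_def)
  have i: "integrable area (\<lambda>z. norm (\<omega> z - k z) powr p)" if "k \<in> Lp p" for k
    using Lp_diff[OF p w that] by (simp add: Lp_def)
  have n: "(\<integral>\<^sup>+z. ennreal (norm (\<omega> z - k z) powr p) \<partial>area) = ennreal (\<integral>z. norm (\<omega> z - k z) powr p \<partial>area)" if "k \<in> Lp p" for k
    by (rule nn_integral_eq_integral[OF i[OF that]]) simp
  have "Lp_norm p (\<lambda>z. \<omega> z - f z) \<le> Lp_norm p (\<lambda>z. \<omega> z - g z)"
  proof -
    \<comment> \<open>An infimum of reals is a lower bound only for a set bounded below; 0 bounds
      all norms.\<close>
    have "bdd_below ((\<lambda>g. Lp_norm p (\<lambda>z. \<omega> z - g z)) ` bergman p)"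
      by (rule bdd_belowI[of _ 0]) (auto simp: Lp_norm_def)
    then show ?thesis using f g by (auto simp: best_approximant_def intro: cINF_lower)
  qed
  then have "(\<integral>z. norm (\<omega> z - f z) powr p \<partial>area) \<le> (\<integral>z. norm (\<omega> z - g z) powr p \<partial>area)"
    using p powr_less_mono2[of "1 / p" "\<integral>z. norm (\<omega> z - g z) powr p \<partial>area" "\<integral>z. norm (\<omega> z - f z) powr p \<partial>area"]
    unfolding Lp_norm_def by (fastforce simp: not_less[symmetric] intro!: Bochner_Integration.integral_nonneg)
  then show ?thesis unfolding n[OF fL] n[OF gL] by (rule ennreal_leI)
qed

lemma emeasure_annulus:
  assumes "0 \<le> r" "r < 1"
  shows "emeasure lborel {z::complex. r < norm z \<and> norm z < 1} = ennreal (pi * (1 - r\<^sup>2))"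
proof -
  have "{z::complex. r < norm z \<and> norm z < 1} = ball 0 1 - cball 0 r" by auto
  also have "emeasure lborel \<dots> = emeasure lborel (ball (0::complex) 1) - emeasure lborel (cball (0::complex) r)"
    using assms by (intro emeasure_Diff emeasure_lborel_cball_finite[THEN less_imp_neq]) auto
  also have "\<dots> = ennreal (pi * (1 - r\<^sup>2))"
    using assms by (simp add: emeasure_ball emeasure_cball unit_ball_vol_2 ennreal_minus right_diff_distrib)
  finally show ?thesis .
qed

lemma nn_integral_area_diff:
  fixes \<omega> W g G :: "complex \<Rightarrow> complex"
  assumes W: "W \<in> borel_measurable borel" "AE z in area. \<omega> z = W z"
    and G: "G \<in> borel_measurable borel" "\<And>z. z \<in> unit_disk \<Longrightarrow> g z = G z"
  shows "(\<integral>\<^sup>+z. ennreal (norm (\<omega> z - g z) powr p) \<partial>area)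
    = ennreal (1 / pi) * (\<integral>\<^sup>+z. indicator unit_disk z * ennreal (norm (W z - G z) powr p) \<partial>lborel)"
proof -
  have "AE z in area. g z = G z" unfolding AE_area_iff using G(2) by simp
  with W(2) have "AE z in area. ennreal (norm (\<omega> z - g z) powr p) = ennreal (norm (W z - G z) powr p)"
    by eventually_elim simp
  then have "(\<integral>\<^sup>+z. ennreal (norm (\<omega> z - g z) powr p) \<partial>area) = (\<integral>\<^sup>+z. ennreal (norm (W z - G z) powr p) \<partial>area)"
    by (rule nn_integral_cong_AE)
  also have "\<dots> = ennreal (1 / pi) * (\<integral>\<^sup>+z. indicator unit_disk z * ennreal (norm (W z - G z) powr p) \<partial>lborel)"
  proof (rule nn_integral_area)
    note [measurable] = W(1) G(1)
    show "(\<lambda>z. ennreal (norm (W z - G z) powr p)) \<in> borel_measurable borel" by measurable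
  qed
  finally show ?thesis .
qed

text \<open>Only the radial combination of the two weak derivatives enters. Its p-th power is
  integrable because the coordinates are at most 1 in modulus on the disk.\<close>

lemma sobolev_dilation_bound:
  assumes p: "1 \<le> p" and \<omega>: "\<omega> \<in> sobolev p"
  obtains W C where "W \<in> borel_measurable borel" "AE z in area. \<omega> z = W z"
    "(\<integral>\<^sup>+z. ennreal (norm (W z) powr p) \<partial>lborel) < \<infinity>" "0 \<le> C"
    "\<And>r. \<lbrakk>1 / 2 \<le> r; r < 1\<rbrakk> \<Longrightarrow>
      (\<integral>\<^sup>+z. indicator unit_disk z * ennreal (norm (W z - W (r *\<^sub>R z)) powr p) \<partial>lborel) \<le> ennreal (C * (1 - r) powr p)"
proof -
  obtain \<xi> \<eta> where L: "\<omega> \<in> Lp p" "\<xi> \<in> Lp p" "\<eta> \<in> Lp p" and wd: "weak_deriv 1 \<omega> \<xi>" "weak_deriv \<i> \<omega> \<eta>"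
    using \<omega> by (auto simp: sobolev_def)
  then have meas: "\<omega> \<in> borel_measurable area" "\<xi> \<in> borel_measurable area" "\<eta> \<in> borel_measurable area"
    by (auto simp: Lp_def)
  obtain W where W: "W \<in> borel_measurable borel" "\<And>z. z \<notin> unit_disk \<Longrightarrow> W z = 0" "AE z in area. \<omega> z = W z"
    "(\<integral>\<^sup>+z. ennreal (norm (W z) powr p) \<partial>lborel) < \<infinity>" "integrable lborel W"
    using Lp_borel_representative[OF p L(1)] by blast
  obtain X where X: "X \<in> borel_measurable borel" "\<And>z. z \<notin> unit_disk \<Longrightarrow> X z = 0" "AE z in area. \<xi> z = X z"
    "(\<integral>\<^sup>+z. ennreal (norm (X z) powr p) \<partial>lborel) < \<infinity>" "integrable lborel X"
    using Lp_borel_representative[OF p L(2)] by blast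
  obtain Y where Y: "Y \<in> borel_measurable borel" "\<And>z. z \<notin> unit_disk \<Longrightarrow> Y z = 0" "AE z in area. \<eta> z = Y z"
    "(\<integral>\<^sup>+z. ennreal (norm (Y z) powr p) \<partial>lborel) < \<infinity>" "integrable lborel Y"
    using Lp_borel_representative[OF p L(3)] by blast
  have wX: "(\<integral>z. W z * of_real (dir_deriv \<phi> 1 z) \<partial>lborel) = - (\<integral>z. X z * of_real (\<phi> z) \<partial>lborel)"
    if "\<phi> \<in> test_functions" for \<phi>
    by (rule weak_deriv_representative[OF wd(1) _ meas(1,2) W(1,2,3) X(1,2,3) that]) (simp_all add: Basis_complex_def)
  have wY: "(\<integral>z. W z * of_real (dir_deriv \<phi> \<i> z) \<partial>lborel) = - (\<integral>z. Y z * of_real (\<phi> z) \<partial>lborel)"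
    if "\<phi> \<in> test_functions" for \<phi>
    by (rule weak_deriv_representative[OF wd(2) _ meas(1,3) W(1,2,3) Y(1,2,3) that]) (simp_all add: Basis_complex_def)
  define I where "I = (\<integral>\<^sup>+w. ennreal (norm (Re w *\<^sub>R X w + Im w *\<^sub>R Y w) powr p) \<partial>lborel)"
  have "I \<le> (\<integral>\<^sup>+w. ennreal (2 powr (p - 1)) * (ennreal (norm (X w) powr p) + ennreal (norm (Y w) powr p)) \<partial>lborel)"
    unfolding I_def
  proof (rule nn_integral_mono)
    fix w :: complex
    have "norm (t *\<^sub>R Q w) powr p \<le> norm (Q w) powr p"
      if "\<bar>t\<bar> \<le> norm w" "\<And>z. z \<notin> unit_disk \<Longrightarrow> Q z = 0" for t :: real and Q :: "complex \<Rightarrow> complex"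
    proof (cases "w \<in> unit_disk")
      case True
      then have "\<bar>t\<bar> \<le> 1" using that(1) by simp
      then show ?thesis using p by (intro powr_mono2) (auto intro: mult_left_le_one_le)
    qed (simp add: that(2))
    from this[OF abs_Re_le_cmod X(2)] this[OF abs_Im_le_cmod Y(2)]
    have "2 powr (p - 1) * (norm (Re w *\<^sub>R X w) powr p + norm (Im w *\<^sub>R Y w) powr p)
        \<le> 2 powr (p - 1) * (norm (X w) powr p + norm (Y w) powr p)"
      by (intro mult_left_mono add_mono) auto
    then have "norm (Re w *\<^sub>R X w + Im w *\<^sub>R Y w) powr p \<le> 2 powr (p - 1) * (norm (X w) powr p + norm (Y w) powr p)"
      using norm_add_powr_le[OF p, of "Re w *\<^sub>R X w" "Im w *\<^sub>R Y w"] by linarith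
    then show "ennreal (norm (Re w *\<^sub>R X w + Im w *\<^sub>R Y w) powr p)
        \<le> ennreal (2 powr (p - 1)) * (ennreal (norm (X w) powr p) + ennreal (norm (Y w) powr p))"
      by (simp add: ennreal_mult'[symmetric] ennreal_plus[symmetric] ennreal_leI del: ennreal_plus)
  qed
  also have "\<dots> = ennreal (2 powr (p - 1)) *
      ((\<integral>\<^sup>+w. ennreal (norm (X w) powr p) \<partial>lborel) + (\<integral>\<^sup>+w. ennreal (norm (Y w) powr p) \<partial>lborel))"
    using X(1) Y(1) by (simp add: nn_integral_cmult nn_integral_add)
  also have "\<dots> < \<infinity>" using X(4) Y(4) by (simp add: ennreal_mult_less_top)
  finally obtain I0 where I0: "I = ennreal I0" "0 \<le> I0" by (cases I) auto
  \<comment> \<open>\<open>I0\<close> is the integral of the p-th power of the radial derivative,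
    and r at least 1/2 makes the remaining factor \<open>r powr (- p - 2)\<close> uniformly
    bounded.\<close>
  define C where "C = (1 / 2) powr (- p - 2) * I0"
  have "(\<integral>\<^sup>+z. indicator unit_disk z * ennreal (norm (W z - W (r *\<^sub>R z)) powr p) \<partial>lborel) \<le> ennreal (C * (1 - r) powr p)"
    if r: "1 / 2 \<le> r" "r < 1" for r
  proof -
    have "0 < r" using r by simp
    have "(\<integral>\<^sup>+z. indicator unit_disk z * ennreal (norm (W z - W (r *\<^sub>R z)) powr p) \<partial>lborel)
        \<le> ennreal ((1 - r) powr p * r powr (- p - 2)) * I"
      unfolding I_def
      by (rule powr_norm_dilation_difference_le)
        (rule W(5) X(5) Y(5) W(2) X(2) Y(2) wX wY \<open>0 < r\<close> r(2) p; assumption)+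
    also have "\<dots> = ennreal ((1 - r) powr p * r powr (- p - 2) * I0)"
      unfolding I0(1) by (rule ennreal_mult'[symmetric]) simp
    also have "\<dots> \<le> ennreal ((1 - r) powr p * (1 / 2) powr (- p - 2) * I0)"
      using r p I0(2) by (intro ennreal_leI mult_right_mono mult_left_mono powr_mono2') auto
    finally show ?thesis by (simp add: C_def mult_ac)
  qed
  moreover have "0 \<le> C" using I0 by (simp add: C_def)
  ultimately show ?thesis using that W(1,3,4) by blast
qed

theorem theorem4p1:
  fixes p :: real and \<omega> f :: "complex \<Rightarrow> complex"
  assumes "1 \<le> p"
    and "\<omega> \<in> sobolev p"
    and "best_approximant p \<omega> f"
  shows "f \<in> hardy p"
proof -
  note p = assms(1)
  have \<omega>L: "\<omega> \<in> Lp p" using assms(2) by (simp add: sobolev_def)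
  have hol: "f holomorphic_on unit_disk" and fL: "f \<in> Lp p"
    using assms(3) by (auto simp: best_approximant_def bergman_def)
  obtain W C where W: "W \<in> borel_measurable borel" "AE z in area. \<omega> z = W z"
    "(\<integral>\<^sup>+z. ennreal (norm (W z) powr p) \<partial>lborel) < \<infinity>" and C: "0 \<le> C"
    and dil: "\<And>r. \<lbrakk>1 / 2 \<le> r; r < 1\<rbrakk> \<Longrightarrow>
      (\<integral>\<^sup>+z. indicator unit_disk z * ennreal (norm (W z - W (r *\<^sub>R z)) powr p) \<partial>lborel) \<le> ennreal (C * (1 - r) powr p)"
    using sobolev_dilation_bound[OF assms(1,2)] by blast
  define F where "F z = indicator unit_disk z *\<^sub>R f z" for z
  have F[measurable]: "F \<in> borel_measurable borel"
    unfolding F_def by (intro borel_measurable_continuous_on_indicator holomorphic_on_imp_continuous_on hol) auto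
  note [measurable] = W(1)
  let ?J = "\<lambda>G. \<integral>\<^sup>+z. indicator unit_disk z * ennreal (norm (W z - G z) powr p) \<partial>lborel"
  have JF: "(\<integral>\<^sup>+z. ennreal (norm (\<omega> z - f z) powr p) \<partial>area) = ennreal (1 / pi) * ?J F"
    by (rule nn_integral_area_diff[OF W(1,2) F]) (simp add: F_def)
  have "(\<integral>\<^sup>+z. ennreal (norm (\<omega> z - f z) powr p) \<partial>area) < \<infinity>"
    using Lp_diff[OF p \<omega>L fL] by (auto simp: Lp_def integrable_iff_bounded)
  then have "?J F < \<infinity>"
    unfolding JF using pi_gt_zero by (auto simp: ennreal_mult_less_top ennreal_eq_0_iff simp del: pi_gt_zero)
  then obtain m where m: "?J F = ennreal m" "0 \<le> m" by (cases "?J F") auto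
  have "?J (\<lambda>_. 0) \<le> (\<integral>\<^sup>+z. ennreal (norm (W z) powr p) \<partial>lborel)"
    by (intro nn_integral_mono) (auto simp: indicator_def)
  also note W(3)
  finally obtain n where n: "?J (\<lambda>_. 0) = ennreal n" "0 \<le> n" by (cases "?J (\<lambda>_. 0)") auto
  \<comment> \<open>The factor \<open>2 powr (p - 1)\<close> comes from splitting \<open>f\<close>
    into \<open>W\<close> and \<open>W - f\<close>; the brackets are the annulus constants for
    \<open>f\<close> and for the zero function.\<close>
  define D where "D = 2 powr (p - 1) * (((1 + p) * m + C) + ((1 + p) * n + C))"
  let ?M = "\<lambda>r. integral {0..2 * pi} (\<lambda>t. norm (f (of_real r * cis t)) powr p)"
  have bound: "?M r \<le> 2 * D" if r: "1 / 2 \<le> r" "r < 1" for r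
  proof -
    have r0: "0 < r" using r by simp
    let ?A = "{z::complex. r < norm z \<and> norm z < 1}"
    have "ennreal (1 / pi) * ?J F \<le> ennreal (1 / pi) * ?J (\<lambda>z. F (r *\<^sub>R z))"
    proof -
      have "(\<integral>\<^sup>+z. ennreal (norm (\<omega> z - f (r *\<^sub>R z)) powr p) \<partial>area) = ennreal (1 / pi) * ?J (\<lambda>z. F (r *\<^sub>R z))"
      proof (rule nn_integral_area_diff[OF W(1,2)])
        fix z :: complex assume "z \<in> unit_disk"
        then have "r * norm z < 1 * 1" using r by (intro mult_strict_mono') auto
        then show "f (r *\<^sub>R z) = F (r *\<^sub>R z)" using r by (simp add: F_def)
      qed measurable
      then show ?thesis
        using best_approximant_nn_integral_le[OF p \<omega>L assms(3) dilation_in_bergman[OF p hol r0 r(2)]] JF by simp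
    qed
    then have min: "?J F \<le> ?J (\<lambda>z. F (r *\<^sub>R z))"
      by (subst (asm) ennreal_mult_le_mult_iff) (auto simp: ennreal_eq_0_iff not_le)
    have 1: "(\<integral>\<^sup>+z. indicator ?A z * ennreal (norm (W z - F z) powr p) \<partial>lborel) \<le> ennreal (((1 + p) * m + C) * (1 - r))"
      by (rule annulus_integral_le[OF W(1) F p r0 r(2) C m(2,1) dil[OF r] min])
    \<comment> \<open>For the zero function the minimality hypothesis is an equality, since a
      dilation of zero is zero.\<close>
    have 2: "(\<integral>\<^sup>+z. indicator ?A z * ennreal (norm (W z - 0) powr p) \<partial>lborel) \<le> ennreal (((1 + p) * n + C) * (1 - r))"
      by (rule annulus_integral_le[OF W(1) _ p r0 r(2) C n(2,1) dil[OF r]]) auto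
    have [measurable]: "?A \<in> sets borel" by measurable
    have "(\<integral>\<^sup>+z. indicator ?A z * ennreal (norm (f z) powr p) \<partial>lborel)
        \<le> (\<integral>\<^sup>+z. ennreal (2 powr (p - 1)) * (indicator ?A z * ennreal (norm (W z - F z) powr p)
            + indicator ?A z * ennreal (norm (W z - 0) powr p)) \<partial>lborel)"
    proof (rule nn_integral_mono)
      fix z
      have "norm (F z) powr p \<le> 2 powr (p - 1) * (norm (W z - F z) powr p + norm (W z - 0) powr p)"
        using norm_add_powr_le[OF p, of "- (W z - F z)" "W z"] unfolding norm_minus_cancel by simp
      then have "ennreal (norm (F z) powr p) \<le> ennreal (2 powr (p - 1)) * (ennreal (norm (W z - F z) powr p) + ennreal (norm (W z - 0) powr p))"
        by (simp add: ennreal_mult'[symmetric] ennreal_plus[symmetric] ennreal_leI del: ennreal_plus)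
      then show "indicator ?A z * ennreal (norm (f z) powr p) \<le> ennreal (2 powr (p - 1)) *
          (indicator ?A z * ennreal (norm (W z - F z) powr p) + indicator ?A z * ennreal (norm (W z - 0) powr p))"
        by (cases "z \<in> ?A") (auto simp: F_def)
    qed
    also have "\<dots> = ennreal (2 powr (p - 1)) * ((\<integral>\<^sup>+z. indicator ?A z * ennreal (norm (W z - F z) powr p) \<partial>lborel)
            + (\<integral>\<^sup>+z. indicator ?A z * ennreal (norm (W z - 0) powr p) \<partial>lborel))"
      by (subst nn_integral_cmult, measurable, subst nn_integral_add, measurable)
    also have "\<dots> \<le> ennreal (2 powr (p - 1)) * (ennreal (((1 + p) * m + C) * (1 - r)) + ennreal (((1 + p) * n + C) * (1 - r)))"
      by (intro mult_left_mono add_mono 1 2) simp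
    also have "\<dots> = ennreal (2 powr (p - 1) * (((1 + p) * m + C) * (1 - r) + ((1 + p) * n + C) * (1 - r)))"
      using p m n C r by (simp add: ennreal_mult'[symmetric] ennreal_plus[symmetric] del: ennreal_plus)
    also have "2 powr (p - 1) * (((1 + p) * m + C) * (1 - r) + ((1 + p) * n + C) * (1 - r)) = D * (1 - r)"
      by (simp add: D_def algebra_simps)
    finally have f_le: "(\<integral>\<^sup>+z. indicator ?A z * ennreal (norm (f z) powr p) \<partial>lborel) \<le> ennreal (D * (1 - r))" .
    have D0: "0 \<le> D" using p m n C by (simp add: D_def)
    have "ennreal (?M r) * ennreal (pi * (1 - r\<^sup>2)) \<le> ennreal (2 * pi) * ennreal (D * (1 - r))"
      using circle_mean_le_annulus[OF hol p less_imp_le[OF r0] r(2)] mult_left_mono[OF f_le, of "ennreal (2 * pi)"]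
      unfolding emeasure_annulus[OF less_imp_le[OF r0] r(2)] by (auto intro: order_trans)
    then have "ennreal (?M r * (pi * (1 - r\<^sup>2))) \<le> ennreal (2 * pi * (D * (1 - r)))"
      using r r0 D0 by (simp add: ennreal_mult''[symmetric] power_le_one)
    then have "?M r * (pi * (1 - r\<^sup>2)) \<le> 2 * pi * (D * (1 - r))"
      using D0 r by (subst (asm) ennreal_le_iff) auto
    \<comment> \<open>The area of the annulus meets the decay D(1 - r): the factor 1 - r cancels,
      and what remains is 1 + r, which exceeds 1.\<close>
    also have "1 - r\<^sup>2 = (1 + r) * (1 - r)" by (simp add: power2_eq_square algebra_simps)
    finally have "(?M r * (1 + r)) * (pi * (1 - r)) \<le> (2 * D) * (pi * (1 - r))"
      by (simp add: mult_ac)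
    then have le: "?M r * (1 + r) \<le> 2 * D" using r by simp
    show ?thesis
    proof (cases "0 \<le> ?M r")
      case True
      then have "?M r * 1 \<le> ?M r * (1 + r)" using r0 by (intro mult_left_mono) auto
      then show ?thesis using le by simp
    qed (use D0 in auto)
  qed
  have "bdd_above (?M ` {0<..<1})"
  proof (rule bdd_aboveI2)
    fix r :: real assume r: "r \<in> {0<..<1}"
    show "?M r \<le> 2 * D"
    proof (cases "1 / 2 \<le> r")
      case False
      then have "?M r \<le> ?M (1 / 2)" using r by (intro circle_mean_mono hol p) auto
      also have "\<dots> \<le> 2 * D" by (rule bound) auto
      finally show ?thesis .
    qed (use bound r in auto)
  qed
  then show ?thesis using hol by (simp add: hardy_def)
qed

end
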